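(* Let $n\geq1$ and let $S_n$ be a polynomial of degree $n$ with leading coefficient $c$. (i) If $K=\{z\in\mathbb C:(1+z)S_n^2(z)\in[0,1]\}\subset[-1,1]$, then $$T^{(K)}_{2n+1}(z)=\frac{(1+z)S_n^2(z)}{c^2}-2\,\mathrm{Cap}(K)^{2n+1}.$$ (ii) If $K=\{z\in\mathbb C:(1-z)S_n^2(z)\in[0,1]\}\subset[-1,1]$, then $$T^{(K)}_{2n+1}(z)=2\,\mathrm{Cap}(K)^{2n+1}-\frac{(1-z)S_n^2(z)}{c^2}.$$
   Context: $\mathrm{Cap}(K)$ is logarithmic capacity. $T^{(K)}_m$ denotes the (unweighted) Chebyshev polynomial of $K$: the monic polynomial of degree $m$ minimizing the sup-norm $\|P_m\|_K$ over all monic polynomials $P_m$ of degree $m$. *)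

theory Defs
  imports "HOL-Probability.Probability" "HOL-Computational_Algebra.Polynomial"
begin

text \<open>Logarithmic kernel log(1/|z-w|), shifted by the constant log D where
  D = diameter K + 1, so that it is nonnegative on K x K (and infinite on the diagonal).\<close>

definition cap_shift :: "complex set \<Rightarrow> real" where
  "cap_shift K = diameter K + 1"

definition shifted_log_kernel :: "real \<Rightarrow> complex \<Rightarrow> complex \<Rightarrow> ennreal" where
  "shifted_log_kernel D z w =
     (if z = w then \<infinity> else ennreal (ln (D / cmod (z - w))))"

text \<open>Logarithmic energy I(mu) = double integral of log(1/|z-w|) of a probability
  measure mu supported on K (an extended real, possibly +infinity).\<close>

definition log_energy :: "complex set \<Rightarrow> complex measure \<Rightarrow> ereal" where
  "log_energy K \<mu> =
     enn2ereal (\<integral>\<^sup>+ z. \<integral>\<^sup>+ w. shifted_log_kernel (cap_shift K) z w \<partial>\<mu> \<partial>\<mu>)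
       - ereal (ln (cap_shift K))"

definition prob_measures_on :: "complex set \<Rightarrow> complex measure set" where
  "prob_measures_on K =
     {\<mu>. prob_space \<mu> \<and> sets \<mu> = sets borel \<and> emeasure \<mu> K = 1}"

definition robin_constant :: "complex set \<Rightarrow> ereal" where
  "robin_constant K = (INF \<mu> \<in> prob_measures_on K. log_energy K \<mu>)"

definition Cap :: "complex set \<Rightarrow> real" where
  "Cap K = (if robin_constant K = \<infinity> then 0 else exp (- real_of_ereal (robin_constant K)))"

definition sup_norm_on :: "complex set \<Rightarrow> complex poly \<Rightarrow> real" where
  "sup_norm_on K p = (SUP z \<in> K. cmod (poly p z))"

definition is_chebyshev_poly :: "complex set \<Rightarrow> nat \<Rightarrow> complex poly \<Rightarrow> bool" where
  "is_chebyshev_poly K m p \<longleftrightarrow>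
     lead_coeff p = 1 \<and> degree p = m \<and>
     (\<forall>q. lead_coeff q = 1 \<and> degree q = m \<longrightarrow> sup_norm_on K p \<le> sup_norm_on K q)"

definition chebyshev_poly :: "complex set \<Rightarrow> nat \<Rightarrow> complex poly" where
  "chebyshev_poly K m = (THE p. is_chebyshev_poly K m p)"

end

theory Submission
  imports Defs
    "HOL-Computational_Algebra.Fundamental_Theorem_Algebra"
    "HOL-Real_Asymp.Real_Asymp"
begin

text \<open>Let \<open>P\<close> have degree \<open>N\<close> and leading coefficient \<open>a\<close>, and let \<open>K\<close> be the preimage of
  \<open>[0, 1]\<close> under \<open>P\<close>. If a monic \<open>q\<close> of degree \<open>N\<close> satisfies \<open>\<bar>q\<bar> \<le> 1 / (2 \<bar>a\<bar>)\<close> on \<open>K\<close>, then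
  \<open>r = a q - P + 1/2\<close> has degree below \<open>N\<close>, lies in the disc \<open>\<bar>r - 1/2\<bar> \<le> 1/2\<close> at the zeros of \<open>P\<close>
  and in \<open>\<bar>r + 1/2\<bar> \<le> 1/2\<close> at those of \<open>P - 1\<close>. By Newton's identities the sums of \<open>r\<close> over both
  root systems agree, so \<open>r\<close> vanishes at all these points, and then \<open>r = 0\<close>. Hence \<open>(P - 1/2) / a\<close>
  is the Chebyshev polynomial.

  For real \<open>K\<close>, pulling the arcsine law on \<open>[0, 1]\<close> back along \<open>P\<close> gives a measure on \<open>K\<close> whose
  potential is constant on \<open>K\<close>, equal to \<open>V = ln (4 \<bar>a\<bar>) / N\<close>. Since the logarithmic kernel on a
  bounded subset of the line is, up to a constant, a limit of positive definite kernels,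
  the energy of every other probability measure is at least \<open>V\<close>, so \<open>Cap K ^ N = 1 / (4 \<bar>a\<bar>)\<close>.

  Finally \<open>c\<^sup>2 > 0\<close>: the zeros of \<open>S\<close> are real, so \<open>S / c\<close> is real on the real line, and
  \<open>(1 \<plusminus> x) S(x)\<^sup>2 = 1\<close> for some \<open>x\<close> in \<open>[-1, 1]\<close>.\<close>

subsection \<open>Chebyshev polynomials of polynomial preimages\<close>

text \<open>Here \<open>B\<close> is the sum of \<open>r(x) Q / (X - x)\<close> over the roots \<open>x\<close> of \<open>Q\<close>; its top coefficient
  gives the sum of \<open>r\<close> over the roots as a coefficient of a remainder modulo \<open>Q\<close>.\<close>

lemma pderiv_times_division:
  fixes X :: "complex multiset" and r :: "complex poly"
  defines "Q \<equiv> (\<Prod>x\<in>#X. [:-x, 1:])"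
  obtains A B where "pderiv Q * r = Q * A + B"
    "\<And>i. i \<ge> size X \<Longrightarrow> coeff B i = 0"
    "\<And>i. i \<ge> degree r \<Longrightarrow> coeff A i = 0"
    "X \<noteq> {#} \<Longrightarrow> coeff B (size X - 1) = (\<Sum>x\<in>#X. poly r x)"
    "\<forall>x\<in>#X. poly r x = 0 \<Longrightarrow> B = 0"
proof -
  have "\<exists>A B. pderiv (\<Prod>x\<in>#X. [:-x, 1:]) * r = (\<Prod>x\<in>#X. [:-x, 1:]) * A + B
      \<and> (\<forall>i\<ge>size X. coeff B i = 0) \<and> (\<forall>i\<ge>degree r. coeff A i = 0)
      \<and> (X \<noteq> {#} \<longrightarrow> coeff B (size X - 1) = (\<Sum>x\<in>#X. poly r x))
      \<and> ((\<forall>x\<in>#X. poly r x = 0) \<longrightarrow> B = 0)"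
  proof (induction X)
    case empty
    show ?case by (intro exI[of _ 0]) simp
  next
    case (add z X)
    define Q where "Q = (\<Prod>x\<in>#X. [:-x, 1:])"
    from add obtain A B where AB: "pderiv Q * r = Q * A + B"
      "\<forall>i\<ge>size X. coeff B i = 0" "\<forall>i\<ge>degree r. coeff A i = 0"
      "X \<noteq> {#} \<longrightarrow> coeff B (size X - 1) = (\<Sum>x\<in>#X. poly r x)"
      "(\<forall>x\<in>#X. poly r x = 0) \<longrightarrow> B = 0"
      unfolding Q_def by blast
    have degQ: "degree Q = size X" "coeff Q (size X) = 1"
    proof -
      have "degree (\<Prod>x\<in>#X. [:-x, 1:]) = size X \<and> lead_coeff (\<Prod>x\<in>#X. [:-x, 1:]) = 1"
      proof (induction X)
        case (add x X)
        then have ne: "(\<Prod>x\<in>#X. [:-x, 1:]) \<noteq> 0" by auto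
        have "lead_coeff ([:-x, 1:] * (\<Prod>x\<in>#X. [:-x, 1:])) = 1"
          using add by (subst lead_coeff_mult) auto
        moreover have "degree ([:-x, 1:] * (\<Prod>x\<in>#X. [:-x, 1:])) = Suc (size X)"
          using add ne by (subst degree_mult_eq) auto
        ultimately show ?case by (simp del: mult_pCons_left)
      qed simp
      then show "degree Q = size X" "coeff Q (size X) = 1" by (auto simp: Q_def)
    qed
    \<comment> \<open>Division of \<open>r\<close> by \<open>X - z\<close> turns the new term
      \<open>Q * r\<close> of the product rule into a multiple of the enlarged product plus
      \<open>poly r z\<close> times \<open>Q\<close>. Since \<open>Q\<close> is monic, this adds
      exactly \<open>poly r z\<close> to the top coefficient.\<close>
    let ?s = "synthetic_div r z"
    have r: "r = [:-z, 1:] * ?s + [:poly r z:]"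
      using synthetic_div_correct'[of z r] by simp
    have cs: "coeff ?s i = 0" if "i \<ge> degree r" for i
    proof (cases "degree r = 0")
      case True
      then have "synthetic_div r z = 0" by (subst synthetic_div_eq_0_iff)
      then show ?thesis by simp
    next
      case False then show ?thesis using that by (intro coeff_eq_0) (simp add: degree_synthetic_div)
    qed
    let ?B = "[:poly r z:] * Q + [:-z, 1:] * B"
    have "pderiv ([:-z, 1:] * Q) * r = Q * r + [:-z, 1:] * (pderiv Q * r)"
      by (simp only: pderiv_mult) (simp add: pderiv_pCons algebra_simps)
    also have "\<dots> = Q * ([:-z, 1:] * ?s + [:poly r z:]) + [:-z, 1:] * (Q * A + B)"
      unfolding AB(1) using r by metis
    also have "\<dots> = ([:-z, 1:] * Q) * (A + ?s) + ?B"
      by (simp only: algebra_simps)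
    finally have 1: "pderiv ([:-z, 1:] * Q) * r = ([:-z, 1:] * Q) * (A + ?s) + ?B" .
    have 2: "\<forall>i\<ge>Suc (size X). coeff ?B i = 0"
      using AB(2) degQ(1) by (auto simp: coeff_pCons coeff_eq_0 split: nat.splits)
    have 3: "coeff ?B (size X) = (\<Sum>x\<in>#add_mset z X. poly r x)"
    proof (cases "X = {#}")
      case True
      then show ?thesis using AB(2,5) degQ by simp
    next
      case False
      then obtain k where "size X = Suc k" by (cases "size X") auto
      then show ?thesis using AB(2,4) degQ False by (simp add: coeff_pCons)
    qed
    show ?case
      using 1 2 3 AB(3,5) cs
      by (intro exI[of _ "A + ?s"] exI[of _ ?B]) (auto simp: Q_def simp del: mult_pCons_left)
  qed
  then show ?thesis using that unfolding Q_def by blast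
qed


text \<open>The monic forms of \<open>P\<close> and \<open>P - 1\<close> differ by a constant, hence
  share their derivative; comparing the two divisions of that derivative times \<open>r\<close>
  equates the two root sums. The two discs lie in opposite half planes and touch only at 0, so every
  root value must be 0.\<close>

lemma poly_eq_0_of_balanced_root_values:
  fixes P r :: "complex poly"
  assumes deg: "degree r < degree P"
    and zeros: "\<And>z. poly P z = 0 \<Longrightarrow> cmod (poly r z - 1 / 2) \<le> 1 / 2"
    and ones: "\<And>z. poly P z = 1 \<Longrightarrow> cmod (poly r z + 1 / 2) \<le> 1 / 2"
  shows "r = 0"
proof -
  define N where "N = degree P"
  define a where "a = lead_coeff P"
  have N: "N > 0" and a: "a \<noteq> 0" using deg by (auto simp: N_def a_def)
  define P1 where "P1 = P - [:1:]"
  have degP1: "degree P1 = N"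
    unfolding P1_def diff_conv_add_uminus N_def
    by (rule degree_add_eq_left) (use N in \<open>simp add: N_def\<close>)
  have leadP1: "lead_coeff P1 = a"
    using N unfolding degP1 by (simp add: P1_def a_def N_def coeff_pCons split: nat.splits)
  have P0: "P \<noteq> 0" "P1 \<noteq> 0" using N degP1 by (auto simp: N_def)
  let ?X = "proots P" and ?Y = "proots P1"
  define Q where "Q = (\<Prod>x\<in>#?X. [:-x, 1:])"
  define Q1 where "Q1 = (\<Prod>x\<in>#?Y. [:-x, 1:])"
  have Q: "P = smult a Q" "P1 = smult a Q1"
    using complex_poly_decompose_multiset[of P] complex_poly_decompose_multiset[of P1]
    by (simp_all add: Q_def Q1_def leadP1 a_def)
  have Q1: "Q1 = Q - [:1 / a:]"
  proof -
    have "smult a Q1 = smult a (Q - [:1 / a:])"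
      using Q a by (simp add: P1_def smult_diff_right one_pCons)
    then show ?thesis using a by (simp add: smult_cancel)
  qed
  have pd: "pderiv Q1 = pderiv Q" by (simp add: Q1 pderiv_diff pderiv_pCons)
  have degQ: "degree Q = N" using Q(1) a by (simp add: N_def)
  have sz: "size ?X = N" "size ?Y = N" by (simp_all add: size_proots_complex degP1 N_def)
  then have ne: "?X \<noteq> {#}" "?Y \<noteq> {#}" using N by auto
  obtain A B where AB: "pderiv Q * r = Q * A + B"
    "\<And>i. i \<ge> N \<Longrightarrow> coeff B i = 0" "\<And>i. i \<ge> degree r \<Longrightarrow> coeff A i = 0"
    "coeff B (N - 1) = (\<Sum>x\<in>#?X. poly r x)" "\<forall>x\<in>#?X. poly r x = 0 \<Longrightarrow> B = 0"
    using pderiv_times_division[of ?X r] ne sz unfolding Q_def by metis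
  obtain A1 B1 where AB1: "pderiv Q1 * r = Q1 * A1 + B1"
    "\<And>i. i \<ge> N \<Longrightarrow> coeff B1 i = 0" "\<And>i. i \<ge> degree r \<Longrightarrow> coeff A1 i = 0"
    "coeff B1 (N - 1) = (\<Sum>x\<in>#?Y. poly r x)" "\<forall>x\<in>#?Y. poly r x = 0 \<Longrightarrow> B1 = 0"
    using pderiv_times_division[of ?Y r] ne sz unfolding Q1_def by metis
  have eq: "Q * (A - A1) = B1 - B - smult (1 / a) A1"
    using AB(1) AB1(1) unfolding pd by (simp add: Q1 algebra_simps)
  \<comment> \<open>Unless \<open>A = A1\<close>, the left side of \<open>eq\<close> has degree at
    least \<open>N\<close>, while the right side has degree below \<open>N\<close>.\<close>
  have A: "A = A1"
  proof (rule ccontr)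
    assume "A \<noteq> A1"
    then have "degree (Q * (A - A1)) \<ge> N"
      using degQ N by (subst degree_mult_eq) auto
    moreover have "degree (Q * (A - A1)) < N"
    proof -
      have "degree (B1 - B - smult (1 / a) A1) \<le> N - 1"
        using AB(2) AB1(2,3) deg by (intro degree_le) (auto simp: N_def)
      then show ?thesis using N unfolding eq by linarith
    qed
    ultimately show False by simp
  qed
  then have B: "B1 - B = smult (1 / a) A1" using eq by simp
  \<comment> \<open>The coefficients of \<open>A1\<close> stop below \<open>degree r\<close>, which
    is at most \<open>N - 1\<close>; this uses the strict degree bound on \<open>r\<close>.\<close>
  have "coeff (B1 - B) (N - 1) = 0"
    unfolding B using AB1(3)[of "N - 1"] deg by (simp add: N_def)
  then have sums: "(\<Sum>x\<in>#?X. poly r x) = (\<Sum>x\<in>#?Y. poly r x)"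
    using AB(4) AB1(4) by simp
  \<comment> \<open>The disc in a form that shows both that the real part is nonnegative and that it
    vanishes only at \<open>w = 0\<close>.\<close>
  have half: "Re w \<ge> (cmod w)\<^sup>2" if "cmod (w - 1 / 2) \<le> 1 / 2" for w :: complex
  proof -
    have "(cmod (w - 1 / 2))\<^sup>2 \<le> (1 / 2)\<^sup>2" using that by (intro power_mono) auto
    then show ?thesis unfolding cmod_power2 by (simp add: power2_eq_square algebra_simps)
  qed
  have X: "Re (poly r x) \<ge> (cmod (poly r x))\<^sup>2" if "x \<in># ?X" for x
    using half[OF zeros[of x]] that P0 by simp
  have Y: "- Re (poly r x) \<ge> (cmod (poly r x))\<^sup>2" if "x \<in># ?Y" for x
  proof -
    have "cmod (- poly r x - 1 / 2) \<le> 1 / 2"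
      using ones[of x] that P0 by (subst norm_minus_cancel[symmetric]) (simp add: P1_def add.commute)
    from half[OF this] show ?thesis by simp
  qed
  have Re_sum: "Re (\<Sum>x\<in>#Z. poly r x) = (\<Sum>x\<in>#Z. Re (poly r x))" for Z
    by (induction Z) auto
  have vanish: "\<forall>x\<in>#Z. f x = 0" if "\<forall>x\<in>#Z. f x \<ge> 0" "(\<Sum>x\<in>#Z. f x) \<le> 0"
    for Z and f :: "complex \<Rightarrow> real"
  proof -
    have "(\<forall>x\<in>#Z. f x \<ge> 0) \<longrightarrow> (\<Sum>x\<in>#Z. f x) \<ge> 0 \<and> ((\<Sum>x\<in>#Z. f x) \<le> 0 \<longrightarrow> (\<forall>x\<in>#Z. f x = 0))"
      by (induction Z) force+
    with that show ?thesis by blast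
  qed
  have nonneg: "(\<Sum>x\<in>#Z. f x) \<ge> 0" if "\<forall>x\<in>#Z. f x \<ge> 0" for Z and f :: "complex \<Rightarrow> real"
    using that by (induction Z) force+
  have posX: "\<forall>x\<in>#?X. Re (poly r x) \<ge> 0" using X by (meson order_trans zero_le_power2)
  have posY: "\<forall>x\<in>#?Y. - Re (poly r x) \<ge> 0" using Y by (meson order_trans zero_le_power2)
  have neg: "(\<Sum>x\<in>#Z. - Re (poly r x)) = - (\<Sum>x\<in>#Z. Re (poly r x))" for Z
    by (induction Z) auto
  have s: "(\<Sum>x\<in>#?X. Re (poly r x)) = (\<Sum>x\<in>#?Y. Re (poly r x))"
    using sums unfolding Re_sum[symmetric] by simp
  have "\<forall>x\<in>#?X. Re (poly r x) = 0"
    using nonneg[OF posY] posX unfolding neg s[symmetric] by (intro vanish) auto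
  then have "\<forall>x\<in>#?X. poly r x = 0" using X by fastforce
  moreover have "\<forall>x\<in>#?Y. - Re (poly r x) = 0"
    using nonneg[OF posX] posY unfolding s by (intro vanish) (auto simp: neg)
  then have "\<forall>x\<in>#?Y. poly r x = 0" using Y by fastforce
  \<comment> \<open>Roots may be multiple, so instead of counting them the remainders are used: both
    vanish, then so does the common quotient, leaving \<open>pderiv Q * r = 0\<close>.\<close>
  ultimately have "B = 0" "B1 = 0" using AB(5) AB1(5) by blast+
  then have "A = 0" using B A a by simp
  then have "pderiv Q * r = 0" using AB(1) \<open>B = 0\<close> by simp
  moreover have "pderiv Q \<noteq> 0" using degQ N by (simp add: pderiv_eq_0_iff)
  ultimately show "r = 0" by simp
qed

lemma bdd_above_cmod_poly:
  assumes "bounded K"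
  shows "bdd_above ((\<lambda>z. cmod (poly p z)) ` K)"
proof -
  have "compact (closure K)" using assms by (simp add: compact_closure)
  then have "bounded ((\<lambda>z. cmod (poly p z)) ` closure K)"
    by (intro compact_imp_bounded compact_continuous_image continuous_intros)
  then have "bdd_above ((\<lambda>z. cmod (poly p z)) ` closure K)" by (rule bounded_imp_bdd_above)
  then show ?thesis by (rule bdd_above_mono) (use closure_subset in auto)
qed

theorem chebyshev_poly_preimage_interval:
  fixes P :: "complex poly"
  assumes deg: "degree P > 0"
    and K: "K = {z. poly P z \<in> complex_of_real ` {0..1}}" "bounded K"
  shows "chebyshev_poly K (degree P) = smult (1 / lead_coeff P) (P - [:1 / 2:])"
proof -
  define N where "N = degree P"
  define a where "a = lead_coeff P"
  define T where "T = smult (1 / a) (P - [:1 / 2:])"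
  have a: "a \<noteq> 0" using deg by (auto simp: a_def)
  have degT: "degree T = N"
  proof -
    have "degree (P + - [:1 / 2:]) = N"
      unfolding N_def by (rule degree_add_eq_left) (use deg in simp)
    then have "degree (P - [:1 / 2:]) = N" by (simp only: diff_conv_add_uminus)
    then show ?thesis using a by (simp add: T_def)
  qed
  have leadT: "lead_coeff T = 1"
    unfolding degT using a deg
    by (simp add: T_def a_def N_def coeff_pCons split: nat.splits)
  have ne: "K \<noteq> {}"
  proof -
    obtain z where "poly P z = 0"
      using fundamental_theorem_of_algebra[of P] deg by (metis constant_degree less_irrefl)
    then have "z \<in> K" by (auto simp: K image_iff intro!: bexI[of _ 0])
    then show ?thesis by blast
  qed
  have normT: "sup_norm_on K T \<le> 1 / (2 * cmod a)"
    unfolding sup_norm_on_def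
  proof (rule cSUP_least[OF ne])
    fix z assume "z \<in> K"
    then obtain t where t: "t \<in> {0..1}" "poly P z = complex_of_real t" by (auto simp: K)
    have "poly T z = complex_of_real (t - 1 / 2) / a" by (simp add: T_def t)
    then have "cmod (poly T z) = \<bar>t - 1 / 2\<bar> / cmod a" by (simp add: norm_divide del: of_real_diff)
    also have "\<dots> \<le> (1 / 2) / cmod a"
    proof (rule divide_right_mono)
      show "\<bar>t - 1 / 2\<bar> \<le> 1 / 2" unfolding abs_le_iff using t by simp
    qed simp
    finally show "cmod (poly T z) \<le> 1 / (2 * cmod a)" by simp
  qed
  \<comment> \<open>This single claim gives minimality as well as the uniqueness behind
    \<open>THE\<close>: a monic \<open>q\<close> is either beaten by \<open>T\<close> outright or
    equal to it.\<close>
  have uniq: "q = T"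
    if q: "lead_coeff q = 1" "degree q = N" "sup_norm_on K q \<le> 1 / (2 * cmod a)" for q
  proof -
    define r where "r = smult a (q - T)"
    have degr: "degree r < degree P"
    proof (cases "q - T = 0")
      case False
      have "degree (q - T) < N"
        using q(1,2) leadT degT False
        by (metis coeff_diff degree_diff_le_max diff_self eq_zero_or_degree_less max.idem)
      then show ?thesis using a by (simp add: r_def N_def)
    qed (use deg in \<open>simp add: r_def\<close>)
    have bound: "cmod (poly r z + poly P z - 1 / 2) \<le> 1 / 2" if "z \<in> K" for z
    proof -
      have "cmod (poly q z) \<le> sup_norm_on K q"
        unfolding sup_norm_on_def by (rule cSUP_upper[OF that bdd_above_cmod_poly[OF K(2)]])
      then have "cmod a * cmod (poly q z) \<le> cmod a * (1 / (2 * cmod a))"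
        using q(3) by (intro mult_left_mono) auto
      moreover have "poly r z + poly P z - 1 / 2 = a * poly q z"
        using a by (simp add: r_def T_def algebra_simps)
      ultimately show ?thesis using a by (simp add: norm_mult)
    qed
    have "r = 0"
    proof (rule poly_eq_0_of_balanced_root_values[OF degr])
      fix z assume z: "poly P z = 0"
      then have "z \<in> K" by (auto simp: K image_iff intro!: bexI[of _ 0])
      from bound[OF this] z show "cmod (poly r z - 1 / 2) \<le> 1 / 2" by simp
    next
      fix z assume z: "poly P z = 1"
      then have "z \<in> K" by (auto simp: K image_iff intro!: bexI[of _ 1])
      from bound[OF this] z show "cmod (poly r z + 1 / 2) \<le> 1 / 2" by (simp add: add_diff_eq[symmetric])
    qed
    then show ?thesis using a by (simp add: r_def)
  qed
  have "is_chebyshev_poly K N T"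
    unfolding is_chebyshev_poly_def using leadT degT normT uniq
    by (metis le_cases order.trans)
  moreover have "p = T" if "is_chebyshev_poly K N p" for p
    using that leadT degT normT unfolding is_chebyshev_poly_def by (metis order.trans uniq)
  ultimately have "chebyshev_poly K N = T"
    unfolding chebyshev_poly_def by (intro the_equality)
  then show ?thesis by (simp only: N_def T_def a_def)
qed

subsection \<open>Positive definiteness of the logarithmic kernel on the line\<close>

text \<open>A squared difference cannot be expanded in \<open>ennreal\<close>, so the larger number
  is written as the smaller plus \<open>c\<close>; the surplus is \<open>c * c\<close>.\<close>

lemma ennreal_two_mult_le_sum_squares: "2 * (a * b) \<le> a * a + b * (b :: ennreal)"
proof (induction a b rule: linorder_wlog)
  case (le a b)
  then obtain c where b: "b = a + c" by (auto simp: le_iff_add)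
  have "2 * (a * b) = a * b + a * b" by (rule mult_2)
  also have "\<dots> = a * a + a * a + a * c + a * c" by (simp add: b distrib_left ac_simps)
  also have "\<dots> \<le> a * a + a * a + a * c + a * c + c * c" by simp
  also have "\<dots> = a * a + b * b" by (simp add: b distrib_left distrib_right ac_simps)
  finally show ?case .
qed (simp add: ac_simps)

text \<open>By Tonelli each energy is the \<open>g\<close>-weighted integral of a product of two
  averages of \<open>h\<close>, which reduces the claim to
  \<open>2 * (a * b) \<le> a * a + b * b\<close> for each \<open>p\<close>. The form without
  subtraction admits infinite energies.\<close>

lemma nn_integral_separable_kernel_cross_le:
  assumes "sigma_finite_measure \<sigma>" "sigma_finite_measure \<mu>" "sigma_finite_measure \<nu>"
    and sets [measurable_cong]: "sets \<mu> = sets M" "sets \<nu> = sets M"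
    and [measurable]: "g \<in> borel_measurable \<sigma>" "(\<lambda>(z, p). h z p) \<in> borel_measurable (M \<Otimes>\<^sub>M \<sigma>)"
  defines "k \<equiv> \<lambda>z w. \<integral>\<^sup>+ p. g p * (h z p * h w p) \<partial>\<sigma> :: ennreal"
  shows "2 * (\<integral>\<^sup>+ z. \<integral>\<^sup>+ w. k z w \<partial>\<nu> \<partial>\<mu>)
    \<le> (\<integral>\<^sup>+ z. \<integral>\<^sup>+ w. k z w \<partial>\<mu> \<partial>\<mu>) + (\<integral>\<^sup>+ z. \<integral>\<^sup>+ w. k z w \<partial>\<nu> \<partial>\<nu>)"
proof -
  have E: "(\<integral>\<^sup>+ z. \<integral>\<^sup>+ w. k z w \<partial>\<nu>' \<partial>\<mu>')
      = (\<integral>\<^sup>+ p. g p * ((\<integral>\<^sup>+ z. h z p \<partial>\<mu>') * (\<integral>\<^sup>+ w. h w p \<partial>\<nu>')) \<partial>\<sigma>)"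
    if "sigma_finite_measure \<mu>'" "sigma_finite_measure \<nu>'"
      and [measurable_cong]: "sets \<mu>' = sets M" "sets \<nu>' = sets M" for \<mu>' \<nu>'
  proof -
    interpret n: pair_sigma_finite \<nu>' \<sigma> using that assms(1) by (simp add: pair_sigma_finite_def)
    interpret m: pair_sigma_finite \<mu>' \<sigma> using that assms(1) by (simp add: pair_sigma_finite_def)
    interpret nn: sigma_finite_measure \<nu>' by fact
    interpret mm: sigma_finite_measure \<mu>' by fact
    have "(\<integral>\<^sup>+ w. k z w \<partial>\<nu>') = (\<integral>\<^sup>+ p. g p * (h z p * (\<integral>\<^sup>+ w. h w p \<partial>\<nu>')) \<partial>\<sigma>)"
      if [measurable]: "z \<in> space M" for z
    proof -
      have "(\<integral>\<^sup>+ w. k z w \<partial>\<nu>') = (\<integral>\<^sup>+ p. \<integral>\<^sup>+ w. g p * (h z p * h w p) \<partial>\<nu>' \<partial>\<sigma>)"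
        unfolding k_def by (rule n.Fubini'[symmetric]) measurable
      also have "\<dots> = (\<integral>\<^sup>+ p. g p * (h z p * (\<integral>\<^sup>+ w. h w p \<partial>\<nu>')) \<partial>\<sigma>)"
        by (intro nn_integral_cong) (simp add: nn_integral_cmult)
      finally show ?thesis .
    qed
    moreover have "space \<mu>' = space M" by (rule sets_eq_imp_space_eq) fact
    ultimately have "(\<integral>\<^sup>+ z. \<integral>\<^sup>+ w. k z w \<partial>\<nu>' \<partial>\<mu>')
        = (\<integral>\<^sup>+ z. \<integral>\<^sup>+ p. g p * (h z p * (\<integral>\<^sup>+ w. h w p \<partial>\<nu>')) \<partial>\<sigma> \<partial>\<mu>')"
      by (intro nn_integral_cong) simp
    also have "\<dots> = (\<integral>\<^sup>+ p. \<integral>\<^sup>+ z. g p * (h z p * (\<integral>\<^sup>+ w. h w p \<partial>\<nu>')) \<partial>\<mu>' \<partial>\<sigma>)"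
      by (rule m.Fubini'[symmetric]) measurable
    also have "\<dots> = (\<integral>\<^sup>+ p. g p * ((\<integral>\<^sup>+ z. h z p \<partial>\<mu>') * (\<integral>\<^sup>+ w. h w p \<partial>\<nu>')) \<partial>\<sigma>)"
      by (intro nn_integral_cong) (simp add: nn_integral_cmult nn_integral_multc)
    finally show ?thesis .
  qed
  interpret sigma_finite_measure \<mu> by fact
  interpret nu: sigma_finite_measure \<nu> by fact
  show ?thesis
    unfolding E[OF assms(2,3) sets] E[OF assms(2,2) sets(1,1)] E[OF assms(3,3) sets(2,2)]
    by (subst nn_integral_cmult[symmetric], measurable, subst nn_integral_add[symmetric], measurable)
       (intro nn_integral_mono, simp only: distrib_left[symmetric] mult.left_commute[of 2 "g _"],
        intro mult_left_mono ennreal_two_mult_le_sum_squares, simp)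
qed

text \<open>Every interval of radius \<open>r\<close> covering both points contributes, so the kernel is
  visibly positive definite; as \<open>R\<close> grows it differs from \<open>ln (1 / \<bar>x - y\<bar>)\<close> by
  a constant up to a uniformly small error.\<close>

definition overlap_kernel :: "real \<Rightarrow> real \<Rightarrow> real \<Rightarrow> ennreal" where
  "overlap_kernel R x y = (\<integral>\<^sup>+ p. ennreal (1 / (2 * (fst p)\<^sup>2)) * indicator {0<..R} (fst p) *
     (indicator {q. \<bar>x - snd q\<bar> \<le> fst q} p * indicator {q. \<bar>y - snd q\<bar> \<le> fst q} p)
     \<partial>(lborel \<Otimes>\<^sub>M lborel))"

lemma overlap_kernel_eq:
  "overlap_kernel R x y =
     (\<integral>\<^sup>+ r. ennreal ((2 * r - \<bar>x - y\<bar>) / (2 * r\<^sup>2)) * indicator {0<..R} r \<partial>lborel)"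
proof -
  have "overlap_kernel R x y = (\<integral>\<^sup>+ r. \<integral>\<^sup>+ s. ennreal (1 / (2 * r\<^sup>2)) * indicator {0<..R} r *
      (indicator {q. \<bar>x - snd q\<bar> \<le> fst q} (r, s) * indicator {q. \<bar>y - snd q\<bar> \<le> fst q} (r, s))
      \<partial>lborel \<partial>lborel)"
    unfolding overlap_kernel_def
    by (subst lborel.nn_integral_fst[symmetric]) (auto intro!: borel_measurable_times_ennreal)
  also have "\<dots> = (\<integral>\<^sup>+ r. ennreal ((2 * r - \<bar>x - y\<bar>) / (2 * r\<^sup>2)) * indicator {0<..R} r \<partial>lborel)"
  proof (intro nn_integral_cong)
    fix r :: real
    have "(\<integral>\<^sup>+ s. (indicator {q. \<bar>x - snd q\<bar> \<le> fst q} (r, s) *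
          indicator {q. \<bar>y - snd q\<bar> \<le> fst q} (r, s)) \<partial>lborel)
        = (\<integral>\<^sup>+ s. indicator {max x y - r .. min x y + r} s \<partial>lborel)"
      by (intro nn_integral_cong) (auto simp: indicator_def)
    \<comment> \<open>If this length is negative the interval of centres is empty, in agreement with
      \<open>ennreal\<close> truncating at 0.\<close>
    also have "\<dots> = ennreal (2 * r - \<bar>x - y\<bar>)"
      by (auto simp: emeasure_lborel_Icc_eq max_def min_def abs_if ennreal_neg)
    finally show "(\<integral>\<^sup>+ s. ennreal (1 / (2 * r\<^sup>2)) * indicator {0<..R} r *
      (indicator {q. \<bar>x - snd q\<bar> \<le> fst q} (r, s) * indicator {q. \<bar>y - snd q\<bar> \<le> fst q} (r, s)) \<partial>lborel)
      = ennreal ((2 * r - \<bar>x - y\<bar>) / (2 * r\<^sup>2)) * indicator {0<..R} r"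
      by (subst nn_integral_cmult)
         (auto intro!: borel_measurable_times_ennreal simp: ennreal_mult'[symmetric] split: split_indicator)
  qed
  finally show ?thesis .
qed

text \<open>Radii below half the distance \<open>d\<close> contribute nothing, and
  \<open>ln r + d / (2 * r)\<close> is an antiderivative of the rest. In the result only
  \<open>- ln d\<close> and the small error \<open>d / (2 * R)\<close> depend on the points.\<close>

lemma overlap_kernel_off_diagonal:
  assumes "x \<noteq> y" "\<bar>x - y\<bar> \<le> 2 * R"
  shows "overlap_kernel R x y = ennreal (ln (2 * R / \<bar>x - y\<bar>) - 1 + \<bar>x - y\<bar> / (2 * R))"
proof -
  define d where "d = \<bar>x - y\<bar>"
  have d: "d > 0" "d / 2 \<le> R" using assms by (auto simp: d_def)
  have "overlap_kernel R x y = (\<integral>\<^sup>+ r. ennreal ((2 * r - d) / (2 * r\<^sup>2)) * indicator {d/2..R} r \<partial>lborel)"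
    unfolding overlap_kernel_eq d_def[symmetric]
    using d by (intro nn_integral_cong)
      (auto simp: indicator_def divide_nonpos_nonneg intro!: ennreal_neg)
  also have "\<dots> = ennreal ((ln R + d / (2 * R)) - (ln (d / 2) + d / (2 * (d / 2))))"
  proof (rule nn_integral_FTC_Icc[OF _ _ _ d(2)])
    fix r assume r: "r \<in> {d / 2..R}"
    then have "r > 0" using d by auto
    then show "((\<lambda>r. ln r + d / (2 * r)) has_real_derivative (2 * r - d) / (2 * r\<^sup>2)) (at r)"
      by (auto intro!: derivative_eq_intros simp: field_simps power2_eq_square)
    show "0 \<le> (2 * r - d) / (2 * r\<^sup>2)" using r by simp
  qed measurable
  also have "(ln R + d / (2 * R)) - (ln (d / 2) + d / (2 * (d / 2))) = ln (2 * R / d) - 1 + d / (2 * R)"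
    using d by (simp add: ln_div ln_mult)
  finally show ?thesis unfolding d_def .
qed

text \<open>The kernel decreases with the distance of its arguments, so the diagonal value dominates
  all off-diagonal ones, and these are unbounded.\<close>

lemma overlap_kernel_diagonal:
  assumes "R > 0"
  shows "overlap_kernel R x x = \<infinity>"
proof -
  have "overlap_kernel R x x \<ge> ennreal b" for b
  proof -
    \<comment> \<open>The second entry makes the logarithm at least \<open>b + 1\<close>; the first
      keeps \<open>d\<close> within the range of the off-diagonal formula.\<close>
    define d where "d = min (2 * R) (2 * R / exp (b + 1))"
    have d: "d > 0" "d \<le> 2 * R" "d \<le> 2 * R / exp (b + 1)" using assms by (auto simp: d_def)
    have "exp (b + 1) \<le> 2 * R / d" using d by (simp add: field_simps)
    then have "b + 1 \<le> ln (2 * R / d)" using d assms by (subst ln_ge_iff) auto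
    then have "ennreal b \<le> ennreal (ln (2 * R / d) - 1 + d / (2 * R))"
      using d assms by (intro ennreal_leI) (smt (verit) divide_nonneg_nonneg)
    also have "\<dots> = overlap_kernel R x (x + d)"
      using d by (subst overlap_kernel_off_diagonal) auto
    also have "\<dots> \<le> overlap_kernel R x x"
      unfolding overlap_kernel_eq using d
      by (intro nn_integral_mono mult_right_mono ennreal_leI divide_right_mono) auto
    finally show ?thesis .
  qed
  from this[of "enn2real (overlap_kernel R x x) + 1"] show ?thesis
    by (cases "overlap_kernel R x x") auto
qed

section \<open>Comparison of the logarithmic kernel with the overlap kernel\<close>

lemma measurable_shifted_log_kernel [measurable]:
  assumes [measurable]: "f \<in> borel_measurable M" "g \<in> borel_measurable M"
  shows "(\<lambda>x. shifted_log_kernel D (f x) (g x)) \<in> borel_measurable M"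
  unfolding shifted_log_kernel_def by measurable

lemma nn_integral_shifted_log_kernel_add_const:
  assumes "prob_space \<mu>" "prob_space \<nu>"
    and [measurable_cong]: "sets \<mu> = sets borel" "sets \<nu> = sets borel"
  shows "(\<integral>\<^sup>+ z. \<integral>\<^sup>+ w. shifted_log_kernel D z w + c \<partial>\<nu> \<partial>\<mu>)
    = (\<integral>\<^sup>+ z. \<integral>\<^sup>+ w. shifted_log_kernel D z w \<partial>\<nu> \<partial>\<mu>) + c"
proof -
  interpret m: prob_space \<mu> by fact
  interpret n: prob_space \<nu> by fact
  have "(\<integral>\<^sup>+ w. shifted_log_kernel D z w + c \<partial>\<nu>) = (\<integral>\<^sup>+ w. shifted_log_kernel D z w \<partial>\<nu>) + c" for z
    by (subst nn_integral_add) (simp_all add: n.emeasure_space_1)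
  then have "(\<integral>\<^sup>+ z. \<integral>\<^sup>+ w. shifted_log_kernel D z w + c \<partial>\<nu> \<partial>\<mu>)
      = (\<integral>\<^sup>+ z. (\<integral>\<^sup>+ w. shifted_log_kernel D z w \<partial>\<nu>) + c \<partial>\<mu>)" by simp
  also have "\<dots> = (\<integral>\<^sup>+ z. \<integral>\<^sup>+ w. shifted_log_kernel D z w \<partial>\<nu> \<partial>\<mu>) + c"
    by (subst nn_integral_add) (simp_all add: m.emeasure_space_1)
  finally show ?thesis .
qed

text \<open>On \<open>K\<close> the kernel plus a constant \<open>c\<close> equals the overlap
  kernel up to \<open>e / 2\<close>. The inequality for the latter carries over because both
  measures have mass 1, so that \<open>c\<close> enters both sides with the same total
  weight.\<close>

lemma shifted_log_kernel_cross_energy_le: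
  assumes "prob_space \<mu>" "prob_space \<nu>"
    and sets [measurable_cong]: "sets \<mu> = sets borel" "sets \<nu> = sets borel"
    and K: "K \<subseteq> \<real>" "AE z in \<mu>. z \<in> K" "AE z in \<nu>. z \<in> K"
    and D: "D > 0" "\<And>z w. z \<in> K \<Longrightarrow> w \<in> K \<Longrightarrow> cmod (z - w) \<le> D"
  shows "2 * (\<integral>\<^sup>+ z. \<integral>\<^sup>+ w. shifted_log_kernel D z w \<partial>\<nu> \<partial>\<mu>)
    \<le> (\<integral>\<^sup>+ z. \<integral>\<^sup>+ w. shifted_log_kernel D z w \<partial>\<mu> \<partial>\<mu>)
      + (\<integral>\<^sup>+ z. \<integral>\<^sup>+ w. shifted_log_kernel D z w \<partial>\<nu> \<partial>\<nu>)"
proof (rule ennreal_le_epsilon)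
  fix e :: real assume e: "e > 0"
  let ?k = "shifted_log_kernel D"
  interpret m: prob_space \<mu> by fact
  interpret n: prob_space \<nu> by fact
  \<comment> \<open>\<open>R \<ge> 2 * D\<close> gives \<open>c \<ge> 0\<close> through
    \<open>ln 4 \<ge> 1\<close>, so that \<open>ennreal c\<close> is faithful;
    \<open>R \<ge> D / e\<close> makes the error \<open>d / (2 * R)\<close> at most
    \<open>e / 2\<close>.\<close>
  define R where "R = max (2 * D) (D / e)"
  define c where "c = ln (2 * R) - 1 - ln D"
  have R: "R \<ge> 2 * D" "R \<ge> D / e" "R > 0" using D by (auto simp: R_def)
  have c: "c \<ge> 0"
  proof -
    have "exp 1 \<le> (4 :: real)" using exp_le by simp
    then have "1 \<le> ln (4 :: real)" by (subst ln_ge_iff) auto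
    also have "ln 4 \<le> ln (2 * R / D)" using R D by (subst ln_le_cancel_iff) (auto simp: field_simps)
    finally show ?thesis using R D by (simp add: c_def ln_div)
  qed
  define G where "G = (\<lambda>z w. overlap_kernel R (Re z) (Re w))"
  have bounds: "?k z w + ennreal c \<le> G z w" "G z w \<le> ?k z w + ennreal c + ennreal (e / 2)"
    if zw: "z \<in> K" "w \<in> K" for z w
  proof -
    obtain x y where xy: "z = of_real x" "w = of_real y" using zw K by (metis Reals_cases subsetD)
    define d where "d = \<bar>x - y\<bar>"
    have cm: "cmod (z - w) = d" by (simp add: xy d_def flip: of_real_diff)
    have "?k z w + ennreal c \<le> G z w \<and> G z w \<le> ?k z w + ennreal c + ennreal (e / 2)"
    proof (cases "x = y")
      case True
      then show ?thesis using R by (simp add: G_def xy overlap_kernel_diagonal shifted_log_kernel_def)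
    next
      case False
      have d: "d > 0" "d \<le> D" using False D(2)[OF zw] by (simp_all add: cm) (simp add: d_def)
      have dR: "d \<le> 2 * R" using d R by linarith
      have G: "G z w = ennreal (ln (2 * R / d) - 1 + d / (2 * R))"
        using False dR by (simp add: G_def xy overlap_kernel_off_diagonal d_def)
      have k: "?k z w = ennreal (ln (D / d))"
        using False cm by (simp add: shifted_log_kernel_def xy)
      have pos: "ln (D / d) \<ge> 0" using d by simp
      have eq: "ln (2 * R / d) - 1 = ln (D / d) + c" using d D R by (simp add: c_def ln_div)
      have "D \<le> e * R" using R(2) e by (simp add: field_simps)
      then have "d / R \<le> e" using d R by (simp add: field_simps)
      then have "d / (2 * R) \<le> e / 2" "d / (2 * R) \<ge> 0" using R d by (simp_all add: field_simps)
      then show ?thesis unfolding G k eq using c pos e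
        by (auto simp flip: ennreal_plus intro!: ennreal_leI)
    qed
    then show "?k z w + ennreal c \<le> G z w" "G z w \<le> ?k z w + ennreal c + ennreal (e / 2)" by auto
  qed
  have up: "(\<integral>\<^sup>+ z. \<integral>\<^sup>+ w. G z w \<partial>\<rho> \<partial>\<rho>) \<le> (\<integral>\<^sup>+ z. \<integral>\<^sup>+ w. ?k z w \<partial>\<rho> \<partial>\<rho>) + ennreal c + ennreal (e / 2)"
    if "prob_space \<rho>" and [measurable_cong]: "sets \<rho> = sets borel" and ae: "AE z in \<rho>. z \<in> K" for \<rho>
  proof -
    interpret prob_space \<rho> by fact
    have "(\<integral>\<^sup>+ z. \<integral>\<^sup>+ w. G z w \<partial>\<rho> \<partial>\<rho>) \<le> (\<integral>\<^sup>+ z. \<integral>\<^sup>+ w. ?k z w + (ennreal c + ennreal (e / 2)) \<partial>\<rho> \<partial>\<rho>)"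
    proof (rule nn_integral_mono_AE)
      show "AE z in \<rho>. (\<integral>\<^sup>+ w. G z w \<partial>\<rho>) \<le> (\<integral>\<^sup>+ w. ?k z w + (ennreal c + ennreal (e / 2)) \<partial>\<rho>)"
        using ae
      proof eventually_elim
        case (elim z)
        have "AE w in \<rho>. G z w \<le> ?k z w + (ennreal c + ennreal (e / 2))"
          using ae by eventually_elim (use bounds(2)[OF elim] in \<open>simp add: add.assoc\<close>)
        then show ?case by (rule nn_integral_mono_AE)
      qed
    qed
    also have "\<dots> = (\<integral>\<^sup>+ z. \<integral>\<^sup>+ w. ?k z w \<partial>\<rho> \<partial>\<rho>) + (ennreal c + ennreal (e / 2))"
      using that by (intro nn_integral_shifted_log_kernel_add_const) auto
    finally show ?thesis by (simp add: add.assoc)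
  qed
  have low: "(\<integral>\<^sup>+ z. \<integral>\<^sup>+ w. ?k z w \<partial>\<nu> \<partial>\<mu>) + ennreal c \<le> (\<integral>\<^sup>+ z. \<integral>\<^sup>+ w. G z w \<partial>\<nu> \<partial>\<mu>)"
  proof -
    have "(\<integral>\<^sup>+ z. \<integral>\<^sup>+ w. ?k z w \<partial>\<nu> \<partial>\<mu>) + ennreal c = (\<integral>\<^sup>+ z. \<integral>\<^sup>+ w. ?k z w + ennreal c \<partial>\<nu> \<partial>\<mu>)"
      using assms by (intro nn_integral_shifted_log_kernel_add_const[symmetric]) auto
    also have "\<dots> \<le> (\<integral>\<^sup>+ z. \<integral>\<^sup>+ w. G z w \<partial>\<nu> \<partial>\<mu>)"
    proof (rule nn_integral_mono_AE)
      show "AE z in \<mu>. (\<integral>\<^sup>+ w. ?k z w + ennreal c \<partial>\<nu>) \<le> (\<integral>\<^sup>+ w. G z w \<partial>\<nu>)"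
        using K(2)
      proof eventually_elim
        case (elim z)
        have "AE w in \<nu>. ?k z w + ennreal c \<le> G z w"
          using K(3) by eventually_elim (rule bounds(1)[OF elim])
        then show ?case by (rule nn_integral_mono_AE)
      qed
    qed
    finally show ?thesis .
  qed
  let ?X = "\<integral>\<^sup>+ z. \<integral>\<^sup>+ w. ?k z w \<partial>\<nu> \<partial>\<mu>"
  let ?Y = "(\<integral>\<^sup>+ z. \<integral>\<^sup>+ w. ?k z w \<partial>\<mu> \<partial>\<mu>) + (\<integral>\<^sup>+ z. \<integral>\<^sup>+ w. ?k z w \<partial>\<nu> \<partial>\<nu>)"
  have "2 * ?X + ennreal (2 * c) = 2 * (?X + ennreal c)"
    using c by (simp add: distrib_left ennreal_mult)
  also have "\<dots> \<le> 2 * (\<integral>\<^sup>+ z. \<integral>\<^sup>+ w. G z w \<partial>\<nu> \<partial>\<mu>)" by (rule mult_left_mono[OF low]) simp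
  also have "\<dots> \<le> (\<integral>\<^sup>+ z. \<integral>\<^sup>+ w. G z w \<partial>\<mu> \<partial>\<mu>) + (\<integral>\<^sup>+ z. \<integral>\<^sup>+ w. G z w \<partial>\<nu> \<partial>\<nu>)"
    unfolding G_def overlap_kernel_def
    by (rule nn_integral_separable_kernel_cross_le[where M = borel])
       (auto intro!: lborel_pair.sigma_finite_measure_axioms m.sigma_finite_measure_axioms n.sigma_finite_measure_axioms
         sets borel_measurable_times_ennreal)
  also have "\<dots> \<le> ((\<integral>\<^sup>+ z. \<integral>\<^sup>+ w. ?k z w \<partial>\<mu> \<partial>\<mu>) + ennreal c + ennreal (e / 2))
      + ((\<integral>\<^sup>+ z. \<integral>\<^sup>+ w. ?k z w \<partial>\<nu> \<partial>\<nu>) + ennreal c + ennreal (e / 2))"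
    using up assms by (intro add_mono) auto
  also have "\<dots> = (?Y + ennreal e) + ennreal (2 * c)"
  proof -
    have "ennreal (2 * c) = ennreal c + ennreal c" "ennreal e = ennreal (e / 2) + ennreal (e / 2)"
      using c e by (simp_all flip: ennreal_plus)
    then show ?thesis by (simp add: ac_simps)
  qed
  \<comment> \<open>The term \<open>2 * c\<close> is finite, so it cancels even when the energies
    are infinite.\<close>
  finally show "2 * ?X \<le> ?Y + ennreal e"
    by (simp add: add.commute[of _ "ennreal (2 * c)"] ennreal_add_left_cancel_le)
qed

subsection \<open>The potential of the arcsine law\<close>

text \<open>The antiderivative \<open>t * ln t - t\<close> is continuous up to 0, so the fundamental
  theorem with derivatives only in the interior applies.\<close>

lemma integrable_on_ln: "ln integrable_on {0..b::real}"
proof (cases "b > 0")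
  case True
  have "(ln has_integral (b * ln b - b) - (0 * ln 0 - 0)) {0..b}"
  proof (rule fundamental_theorem_of_calculus_interior[OF less_imp_le[OF True]])
    have "((\<lambda>t::real. t * ln t - t) \<longlongrightarrow> 0) (at_right 0)" by real_asymp
    then have "continuous (at 0 within {0..b}) (\<lambda>t. t * ln t - t)"
      using at_within_Icc_at_right[of 0 b] True by (simp add: continuous_within)
    moreover have "continuous (at t within {0..b}) (\<lambda>t. t * ln t - t)" if "t \<noteq> 0" for t :: real
      using that by (intro continuous_intros) auto
    ultimately show "continuous_on {0..b} (\<lambda>t. t * ln t - t)"
      unfolding continuous_on_eq_continuous_within by metis
  next
    fix t :: real assume "t \<in> {0<..<b}"
    then show "((\<lambda>t. t * ln t - t) has_vector_derivative ln t) (at t)"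
      unfolding has_real_derivative_iff_has_vector_derivative[symmetric]
      by (auto intro!: derivative_eq_intros)
  qed
  then show ?thesis by blast
next
  case False
  then show ?thesis using integrable_on_refl[of ln "0 :: real"] by (cases "b = 0") auto
qed

text \<open>On this range the cosine is at least 1/2. The bound serves to dominate
  \<open>ln (sin t)\<close> near 0 by the integrable \<open>ln 2 - ln t\<close>.\<close>

lemma half_le_sin:
  assumes "0 \<le> t" "t \<le> pi / 3"
  shows "t / 2 \<le> sin t"
proof -
  have "sin 0 - 0 / 2 \<le> sin t - t / 2"
  proof (rule DERIV_nonneg_imp_nondecreasing[OF assms(1)])
    fix x assume x: "0 \<le> x" "x \<le> t"
    have "cos (pi / 3) \<le> cos x" using x assms by (intro cos_monotone_0_pi_le) auto
    then show "\<exists>y. ((\<lambda>x. sin x - x / 2) has_real_derivative y) (at x) \<and> 0 \<le> y"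
      by (intro exI[of _ "cos x - 1 / 2"]) (auto intro!: derivative_eq_intros simp: cos_60)
  qed
  then show ?thesis by simp
qed

text \<open>Euler's duplication argument: \<open>sin (2 * t)\<close> is
  \<open>2 * sin t * cos t\<close>, and the logarithms of all three trigonometric factors have the
  same integral \<open>J\<close> over a period, so \<open>J = pi * ln 2 + J + J\<close>. Periodicity
  allows the free starting point \<open>c\<close>.\<close>

lemma has_integral_ln_abs_sin:
  assumes "- pi / 2 \<le> c" "c \<le> pi / 2"
  shows "((\<lambda>t. ln \<bar>sin t\<bar>) has_integral - (pi * ln 2)) {c..c + pi}"
proof -
  define f where "f = (\<lambda>t::real. ln \<bar>sin t\<bar>)"
  have per: "f (t + pi) = f t" "f (t - pi) = f t" "f (- t) = f t" for t
    by (simp_all add: f_def)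
  have r1: "f integrable_on {0..pi/3}"
  proof (rule measurable_bounded_by_integrable_imp_integrable)
    show "f \<in> borel_measurable (lebesgue_on {0..pi/3})"
      unfolding f_def by (intro measurable_restrict_space1 measurable_completion) measurable
    show "(\<lambda>t. ln 2 - ln t) integrable_on {0..pi/3}"
      by (intro integrable_diff integrable_on_ln) auto
    fix t :: real assume t: "t \<in> {0..pi/3}"
    show "norm (f t) \<le> ln 2 - ln t"
    proof (cases "t = 0")
      case False
      then have pos: "sin t > 0" "t / 2 \<le> sin t" using t half_le_sin[of t] by auto
      then have "ln (t / 2) \<le> ln (sin t)" using t False by (subst ln_le_cancel_iff) auto
      moreover have "ln (sin t) \<le> 0" using pos by simp
      ultimately show ?thesis using t False pos by (simp add: f_def ln_div)
    qed (simp add: f_def)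
  qed auto
  have r2: "f integrable_on {pi/3..pi/2}"
  proof (rule integrable_continuous_real)
    have "sin t > 0" if "t \<in> {pi/3..pi/2}" for t
      using that pi_gt_zero by (intro sin_gt_zero) (auto simp del: pi_gt_zero)
    then show "continuous_on {pi/3..pi/2} f"
      unfolding f_def by (intro continuous_intros) force
  qed
  have r: "f integrable_on {0..pi/2}"
    by (rule Henstock_Kurzweil_Integration.integrable_combine[OF _ _ r1 r2]) auto
  then have "(\<lambda>t. f (- t)) integrable_on {- (pi/2)..- 0}"
    unfolding integrable_on_def using has_integral_reflect_lemma_real[of f _ 0 "pi/2"] by blast
  then have l: "f integrable_on {- (pi/2)..0}" by (simp add: per)
  have int: "f integrable_on {- (pi/2)..pi/2}"
    by (rule Henstock_Kurzweil_Integration.integrable_combine[OF _ _ l r]) auto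
  define J where "J = integral {- (pi/2)..pi/2} f"
  have shift: "(f has_integral i) {a + pi..b + pi}" if "(f has_integral i) {a..b}" for i a b
    using has_integral_affinity'[of f i a b 1 "- pi"] that by (simp add: per)
  have period: "(f has_integral J) {c..c + pi}" if c: "- (pi/2) \<le> c" "c \<le> pi/2" for c
  proof -
    have i: "f integrable_on {- (pi/2)..c}" "f integrable_on {c..pi/2}"
      using int c by (auto intro: integrable_on_subinterval)
    have "(f has_integral integral {- (pi/2)..c} f) {pi/2..c + pi}"
      using shift[OF integrable_integral[OF i(1)]] by (simp add: field_simps)
    with integrable_integral[OF i(2)]
    have "(f has_integral integral {c..pi/2} f + integral {- (pi/2)..c} f) {c..c + pi}"
      by (rule has_integral_combine[rotated 2]) (use c in auto)
    moreover have "integral {- (pi/2)..c} f + integral {c..pi/2} f = J"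
      unfolding J_def by (rule Henstock_Kurzweil_Integration.integral_combine[OF c int])
    ultimately show ?thesis by (simp add: add.commute)
  qed
  have "J = - (pi * ln 2)"
  proof -
    have 1: "(f has_integral J) {0..pi}" using period[of 0] by simp
    have "(f has_integral J) {- pi..0}"
      using has_integral_affinity'[of f J 0 pi 1 "pi"] 1 by (simp add: per)
    from has_integral_combine[OF _ _ this 1]
    have "(f has_integral J + J) {- pi..pi}" by simp
    \<comment> \<open>Doubling the argument halves the integral over two periods, which brings it
      back to \<open>J\<close>.\<close>
    from has_integral_affinity'[of f "J + J" "-pi" pi 2 0] this
    have dbl: "((\<lambda>t. f (2 * t)) has_integral J) {- (pi/2)..pi/2}" by simp
    have 2: "((\<lambda>t. f (t + pi/2)) has_integral J) {- (pi/2)..pi/2}"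
      using has_integral_affinity'[of f J 0 pi 1 "pi/2"] 1 by simp
    have 3: "(f has_integral J) {- (pi/2)..pi/2}"
      using period[of "- (pi/2)"] by simp
    have 4: "((\<lambda>_. ln 2 :: real) has_integral pi * ln 2) {- (pi/2)..pi/2}"
      using has_integral_const_real[of "ln 2 :: real" "-(pi/2)" "pi/2"] by simp
    have "((\<lambda>t. f (2 * t)) has_integral pi * ln 2 + J + J) {- (pi/2)..pi/2}"
    proof (rule has_integral_spike_finite[OF _ _ has_integral_add[OF has_integral_add[OF 4 3] 2]])
      show "finite {- (pi/2), 0, pi/2}" by simp
      fix t assume t: "t \<in> {- (pi/2)..pi/2} - {- (pi/2), 0, pi/2}"
      have "cos t > 0" using t by (intro cos_gt_zero_pi) auto
      moreover have "sin t \<noteq> 0" using t sin_eq_0_pi[of t] pi_gt_zero by force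
      moreover have "sin (t + pi/2) = cos t" by (simp add: sin_add)
      ultimately show "f (2 * t) = ln 2 + f t + f (t + pi/2)"
        by (simp add: f_def sin_double abs_mult ln_mult)
    qed
    with dbl have "J = pi * ln 2 + J + J" by (rule has_integral_unique)
    then show ?thesis by simp
  qed
  with period[of c] assms show ?thesis by (simp add: f_def)
qed

text \<open>With \<open>u = (1 + cos \<phi>) / 2\<close> the difference factors, up to sign, into
  the sines of \<open>(\<theta> + \<phi>) / 2\<close> and \<open>(\<phi> - \<theta>) / 2\<close>.
  Reflection joins their logarithms into one integral over \<open>{- pi..pi}\<close>, a full period
  of the halved angle, so \<open>\<phi>\<close> drops out.\<close>

lemma has_integral_arcsine_potential:
  assumes "u \<in> {0..1}"
  shows "((\<lambda>\<theta>. ln \<bar>u - (1 + cos \<theta>) / 2\<bar>) has_integral - (pi * ln 4)) {0..pi}"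
proof -
  define \<phi> where "\<phi> = arccos (2 * u - 1)"
  have \<phi>: "0 \<le> \<phi>" "\<phi> \<le> pi" "u = (1 + cos \<phi>) / 2"
    using assms by (auto simp: \<phi>_def arccos_lbound arccos_ubound)
  define g where "g = (\<lambda>\<theta>. ln \<bar>sin ((\<theta> + \<phi>) / 2)\<bar>)"
  have "((\<lambda>t. ln \<bar>sin t\<bar>) has_integral - (pi * ln 2)) {(\<phi> - pi) / 2..(\<phi> - pi) / 2 + pi}"
    using \<phi> by (intro has_integral_ln_abs_sin) auto
  from has_integral_affinity'[of _ _ _ _ "1/2" "\<phi> / 2", OF this[folded cbox_interval]]
  have g: "(g has_integral - (pi * ln 4)) {- pi..pi}"
    using ln_realpow[of 2 2] by (simp add: g_def field_simps)
  then have i: "g integrable_on {- pi..0}" "g integrable_on {0..pi}"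
    by (auto intro: integrable_on_subinterval dest!: has_integral_integrable)
  have "integral {- pi..0} g + integral {0..pi} g = - (pi * ln 4)"
    using g by (subst Henstock_Kurzweil_Integration.integral_combine) auto
  moreover have "((\<lambda>\<theta>. g (- \<theta>)) has_integral integral {- pi..0} g) {0..pi}"
    using has_integral_reflect_lemma_real[OF integrable_integral[OF i(1)]] by simp
  ultimately have sum: "((\<lambda>\<theta>. g (- \<theta>) + g \<theta>) has_integral - (pi * ln 4)) {0..pi}"
    using has_integral_add[OF _ integrable_integral[OF i(2)]] by metis
  show ?thesis
  proof (rule has_integral_spike_finite[OF _ _ sum])
    show "finite {0, pi, \<phi>}" by simp
    fix \<theta> assume \<theta>: "\<theta> \<in> {0..pi} - {0, pi, \<phi>}"
    have "sin ((\<theta> + \<phi>) / 2) > 0" using \<theta> \<phi> by (intro sin_gt_zero) auto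
    moreover have "sin ((\<phi> - \<theta>) / 2) \<noteq> 0"
      using \<theta> \<phi> sin_eq_0_pi[of "(\<phi> - \<theta>) / 2"] by auto
    moreover have "u - (1 + cos \<theta>) / 2 = sin ((\<theta> + \<phi>) / 2) * - sin ((\<phi> - \<theta>) / 2)"
    proof -
      have "sin ((\<theta> - \<phi>) / 2) = - sin ((\<phi> - \<theta>) / 2)"
        unfolding sin_minus[symmetric] by (rule arg_cong[where f = sin]) (simp add: field_simps)
      then show ?thesis using cos_diff_cos[of \<phi> \<theta>] by (simp add: \<phi> field_simps)
    qed
    ultimately show "ln \<bar>u - (1 + cos \<theta>) / 2\<bar> = g (- \<theta>) + g \<theta>"
      by (simp add: g_def abs_mult ln_mult)
  qed
qed

subsection \<open>Pulling back along a polynomial\<close>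

lemma rsquarefree_complex_card_roots:
  fixes Q :: "complex poly"
  assumes "rsquarefree Q"
  shows "card {z. poly Q z = 0} = degree Q"
proof -
  have "degree (smult (lead_coeff Q) (\<Prod>z|poly Q z = 0. [:-z, 1:])) = card {z. poly Q z = 0}"
    using assms by (simp add: rsquarefree_def degree_prod_sum_eq)
  then show ?thesis by (simp only: complex_poly_decompose_rsquarefree[OF assms])
qed

text \<open>Logarithm of the factorisation of \<open>Q\<close> into distinct linear factors; it
  trades a sum of kernels over a fibre for one logarithm of \<open>poly Q \<zeta>\<close>.\<close>

lemma sum_ln_dist_roots:
  fixes Q :: "complex poly"
  assumes Q: "rsquarefree Q" "poly Q \<zeta> \<noteq> 0" and "D > 0"
  shows "(\<Sum>z | poly Q z = 0. ln (D / cmod (\<zeta> - z)))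
    = degree Q * ln D + ln (cmod (lead_coeff Q)) - ln (cmod (poly Q \<zeta>))"
proof -
  have "Q \<noteq> 0" using Q by auto
  let ?R = "{z. poly Q z = 0}"
  have ne: "\<zeta> - z \<noteq> 0" if "z \<in> ?R" for z using that Q by auto
  have "poly Q \<zeta> = lead_coeff Q * (\<Prod>z\<in>?R. \<zeta> - z)"
    by (subst complex_poly_decompose_rsquarefree[OF Q(1), symmetric]) (simp add: poly_prod)
  then have "ln (cmod (poly Q \<zeta>)) = ln (cmod (lead_coeff Q)) + ln (\<Prod>z\<in>?R. cmod (\<zeta> - z))"
    using Q by (simp add: norm_mult prod_norm ln_mult)
  also have "ln (\<Prod>z\<in>?R. cmod (\<zeta> - z)) = (\<Sum>z\<in>?R. ln (cmod (\<zeta> - z)))"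
    using ne poly_roots_finite[OF \<open>Q \<noteq> 0\<close>] by (intro ln_prod) auto
  also have "(\<Sum>z\<in>?R. ln (cmod (\<zeta> - z))) = (\<Sum>z\<in>?R. ln D - ln (D / cmod (\<zeta> - z)))"
    using ne \<open>D > 0\<close> by (intro sum.cong) (auto simp: ln_div)
  finally show ?thesis
    by (simp add: sum_subtractf rsquarefree_complex_card_roots[OF Q(1)])
qed

section \<open>Measurable enumeration of the fibres of a continuous function\<close>

lemma sets_borel_image_compact_Ioc:
  fixes p :: "real \<Rightarrow> real"
  assumes "compact L" "continuous_on L p"
  shows "p ` (L \<inter> {q<..t}) \<in> sets borel"
proof -
  \<comment> \<open>Continuous images of compact sets are compact, while images of Borel sets need
    not be Borel; so the half-open piece is exhausted by compact ones.\<close>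
  have "L \<inter> {q<..t} = (\<Union>n. L \<inter> {q + 1 / real (Suc n)..t})"
  proof -
    have "\<exists>n. q + 1 / real (Suc n) \<le> x" if "q < x" for x
      using reals_Archimedean[of "x - q"] that by (auto simp: inverse_eq_divide field_simps intro: less_imp_le)
    moreover have "q < x" if "q + 1 / real (Suc n) \<le> x" for x n
      using that by (smt (verit) divide_pos_pos of_nat_0_less_iff zero_less_Suc)
    ultimately show ?thesis by auto
  qed
  then have "p ` (L \<inter> {q<..t}) = (\<Union>n. p ` (L \<inter> {q + 1 / real (Suc n)..t}))"
    by (simp only: image_UN)
  moreover have "p ` (L \<inter> {a..t}) \<in> sets borel" for a
    using assms by (intro borel_compact compact_continuous_image)
      (auto intro: continuous_on_subset compact_Int_closed)
  ultimately show ?thesis by auto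
qed

text \<open>Induction on \<open>k\<close>: a rational \<open>q < t\<close> separates the largest of
  \<open>Suc k\<close> fibre points from the others, which turns the condition into a countable
  union of Borel ones.\<close>

lemma sets_borel_card_fibre_ge:
  fixes p :: "real \<Rightarrow> real"
  assumes L: "compact L" "continuous_on L p" and fin: "\<And>w. finite {x \<in> L. p x = w}"
  shows "{w. k \<le> card {x \<in> L. p x = w \<and> x \<le> t}} \<in> sets borel"
proof (induction k arbitrary: t)
  case (Suc k)
  let ?F = "\<lambda>w t. {x \<in> L. p x = w \<and> x \<le> t}"
  have fin': "finite (?F w t)" for w t by (rule finite_subset[OF _ fin[of w]]) auto
  have "{w. Suc k \<le> card (?F w t)}
      = (\<Union>q\<in>\<rat> \<inter> {..<t}. {w. k \<le> card (?F w q)} \<inter> p ` (L \<inter> {q<..t}))"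
  proof (intro equalityI subsetI)
    fix w assume "w \<in> {w. Suc k \<le> card (?F w t)}"
    then have c: "Suc k \<le> card (?F w t)" by simp
    then have ne: "?F w t \<noteq> {}" by force
    define m where "m = Max (?F w t)"
    have m: "m \<in> ?F w t" using Max_in[OF fin' ne] by (simp add: m_def)
    have max: "x \<le> m" if "x \<in> ?F w t" for x using Max_ge[OF fin' that] by (simp add: m_def)
    \<comment> \<open>Inserting \<open>m - 1\<close> keeps the set nonempty when \<open>m\<close> is
      the only fibre point.\<close>
    have "Max (insert (m - 1) (?F w t - {m})) < m"
      using fin' max by (subst Max_less_iff) (auto simp: less_le)
    then obtain q where q: "q \<in> \<rat>" "Max (insert (m - 1) (?F w t - {m})) < q" "q < m"
      using Rats_dense_in_real by blast
    have "x < q" if "x \<in> ?F w t - {m}" for x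
      using q(2) fin' that by (subst (asm) Max_less_iff) auto
    then have "?F w t - {m} \<subseteq> ?F w q" by fastforce
    then have "card (?F w t - {m}) \<le> card (?F w q)" by (rule card_mono[OF fin'])
    then have "k \<le> card (?F w q)" using c m fin' by (simp add: card_Diff_singleton)
    moreover have "q < t" using m q by auto
    moreover have "w \<in> p ` (L \<inter> {q<..t})" using m q by auto
    ultimately show "w \<in> (\<Union>q\<in>\<rat> \<inter> {..<t}. {w. k \<le> card (?F w q)} \<inter> p ` (L \<inter> {q<..t}))"
      using q by blast
  next
    fix w assume "w \<in> (\<Union>q\<in>\<rat> \<inter> {..<t}. {w. k \<le> card (?F w q)} \<inter> p ` (L \<inter> {q<..t}))"
    then obtain q x where q: "q < t" "k \<le> card (?F w q)" "x \<in> L" "q < x" "x \<le> t" "p x = w" by auto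
    have "Suc k \<le> card (insert x (?F w q))" using q fin' by (subst card_insert_disjoint) auto
    also have "\<dots> \<le> card (?F w t)" using q fin' by (intro card_mono) auto
    finally show "w \<in> {w. Suc k \<le> card (?F w t)}" by simp
  qed
  moreover have "countable (\<rat> \<inter> {..<t})" by (intro countable_Int1 countable_rat)
  ultimately show ?case
    using Suc.IH sets_borel_image_compact_Ioc[OF L] by (auto intro!: sets.countable_UN')
qed simp

text \<open>Converts sublevel sets of the enumeration into counting conditions; list positions start
  at 0, whence \<open>Suc k\<close>.\<close>

lemma sorted_list_of_set_nth_le_iff:
  fixes A :: "'a :: linorder set"
  assumes "finite A" "k < card A"
  shows "sorted_list_of_set A ! k \<le> t \<longleftrightarrow> Suc k \<le> card {x \<in> A. x \<le> t}"
proof -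
  define xs where "xs = sorted_list_of_set A"
  have xs: "sorted xs" "distinct xs" "set xs = A" "length xs = card A"
    using assms by (simp_all add: xs_def)
  show ?thesis unfolding xs_def[symmetric]
  proof
    assume le: "xs ! k \<le> t"
    have "set (take (Suc k) xs) \<subseteq> {x \<in> A. x \<le> t}"
    proof
      fix x assume "x \<in> set (take (Suc k) xs)"
      then obtain i where "i < Suc k" "i < length xs" "x = xs ! i"
        by (auto simp: in_set_conv_nth)
      moreover from this have "xs ! i \<le> xs ! k"
        using xs assms by (intro sorted_nth_mono) auto
      ultimately show "x \<in> {x \<in> A. x \<le> t}" using le xs by auto
    qed
    then have "card (set (take (Suc k) xs)) \<le> card {x \<in> A. x \<le> t}"
      using assms by (intro card_mono) auto
    then show "Suc k \<le> card {x \<in> A. x \<le> t}"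
      using xs assms by (simp add: distinct_card distinct_take)
  next
    assume c: "Suc k \<le> card {x \<in> A. x \<le> t}"
    show "xs ! k \<le> t"
    proof (rule ccontr)
      assume gt: "\<not> xs ! k \<le> t"
      have "{x \<in> A. x \<le> t} \<subseteq> set (take k xs)"
      proof
        fix x assume x: "x \<in> {x \<in> A. x \<le> t}"
        then obtain i where i: "i < length xs" "x = xs ! i" using xs by (auto simp: in_set_conv_nth)
        have "i < k"
        proof (rule ccontr)
          assume "\<not> i < k"
          then have "xs ! k \<le> xs ! i" using xs i by (intro sorted_nth_mono) auto
          then show False using gt x i by auto
        qed
        then show "x \<in> set (take k xs)" using i by (auto simp: in_set_conv_nth)
      qed
      then have "card {x \<in> A. x \<le> t} \<le> card (set (take k xs))" by (intro card_mono) auto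
      also have "\<dots> \<le> k" using card_length[of "take k xs"] by simp
      finally show False using c by simp
    qed
  qed
qed

text \<open>Sublevel sets of the selection are counting conditions on fibres, already known to be
  Borel. The default \<open>c\<close> covers levels outside \<open>G\<close>, where the fibre may be
  too small.\<close>

lemma measurable_fibre_selection:
  fixes p :: "real \<Rightarrow> real"
  assumes L: "compact L" "continuous_on L p" and fin: "\<And>w. finite {x \<in> L. p x = w}"
    and G [measurable]: "G \<in> sets borel" and card: "\<And>w. w \<in> G \<Longrightarrow> k < card {x \<in> L. p x = w}"
  shows "(\<lambda>w. if w \<in> G then sorted_list_of_set {x \<in> L. p x = w} ! k else c) \<in> borel_measurable borel"
  unfolding borel_measurable_iff_le
proof (intro allI)
  fix t
  let ?A = "{w. Suc k \<le> card {x \<in> L. p x = w \<and> x \<le> t}}"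
  have [measurable]: "?A \<in> sets borel" by (rule sets_borel_card_fibre_ge[OF L fin])
  have "{w \<in> space borel. (if w \<in> G then sorted_list_of_set {x \<in> L. p x = w} ! k else c) \<le> t}
      = (G \<inter> ?A) \<union> (if c \<le> t then - G else {})"
    using sorted_list_of_set_nth_le_iff[OF fin card] by (auto simp: conj_assoc)
  also have "\<dots> \<in> sets borel" by auto
  finally show "{w \<in> space borel. (if w \<in> G then sorted_list_of_set {x \<in> L. p x = w} ! k else c) \<le> t} \<in> sets borel" .
qed

section \<open>The measure with constant potential\<close>

lemma nn_integral_arcsine_potential:
  assumes u: "u \<in> {0..1}" and fin: "finite E"
    and f: "\<And>\<theta>. \<theta> \<in> {0..pi} - E \<Longrightarrow>
      f \<theta> = ennreal (c - ln \<bar>u - (1 + cos \<theta>) / 2\<bar>) \<and> 0 \<le> c - ln \<bar>u - (1 + cos \<theta>) / 2\<bar>"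
    and [measurable]: "f \<in> borel_measurable borel"
  shows "(\<integral>\<^sup>+ \<theta>. f \<theta> \<partial>uniform_measure lborel {0..pi}) = ennreal (c + ln 4)"
    and "0 \<le> c + ln 4"
proof -
  define h where "h = (\<lambda>\<theta>. c - ln \<bar>u - (1 + cos \<theta>) / 2\<bar>)"
  \<comment> \<open>Passing from the gauge integral to the Lebesgue integral requires a function
    that is nonnegative everywhere; inside the interval \<open>max 0\<close> alters \<open>h\<close>
    at most on the finite set \<open>E\<close>.\<close>
  define g where "g = (\<lambda>\<theta>. if \<theta> \<in> {0..pi} then max 0 (h \<theta>) else 0)"
  have [measurable]: "h \<in> borel_measurable borel" unfolding h_def by measurable
  have "(h has_integral pi * c - - (pi * ln 4)) {0..pi}"
    unfolding h_def
    using has_integral_diff[OF has_integral_const_real[of c 0 pi] has_integral_arcsine_potential[OF u]]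
    by simp
  then have h: "(h has_integral pi * (c + ln 4)) {0..pi}" by (simp add: algebra_simps)
  have "((\<lambda>\<theta>. max 0 (h \<theta>)) has_integral pi * (c + ln 4)) {0..pi}"
    by (rule has_integral_spike_finite[OF fin _ h]) (use f in \<open>simp add: h_def\<close>)
  then have g: "(g has_integral pi * (c + ln 4)) UNIV"
    unfolding g_def by (simp only: has_integral_restrict_UNIV)
  have "pi * (c + ln 4) \<ge> 0" by (rule has_integral_nonneg[OF g]) (simp add: g_def)
  then show nonneg: "0 \<le> c + ln 4" using zero_le_mult_iff[of pi "c + ln 4"] pi_gt_zero by linarith
  have "(\<integral>\<^sup>+ \<theta>. f \<theta> * indicator {0..pi} \<theta> \<partial>lborel) = (\<integral>\<^sup>+ \<theta>. ennreal (g \<theta>) \<partial>lborel)"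
  proof (rule nn_integral_cong_AE)
    have "AE \<theta> in lborel. \<theta> \<notin> E"
      using fin by (intro AE_not_in) (auto simp: finite_imp_null_set_lborel)
    then show "AE \<theta> in lborel. f \<theta> * indicator {0..pi} \<theta> = ennreal (g \<theta>)"
      by eventually_elim (use f in \<open>auto simp: g_def h_def indicator_def\<close>)
  qed
  also have "\<dots> = ennreal (pi * (c + ln 4))"
    by (rule nn_integral_has_integral_lborel[OF _ _ g]) (auto simp: g_def)
  finally show "(\<integral>\<^sup>+ \<theta>. f \<theta> \<partial>uniform_measure lborel {0..pi}) = ennreal (c + ln 4)"
    using nonneg by (simp add: nn_integral_uniform_measure divide_ennreal)
qed

text \<open>\<open>\<omega>\<close> averages the uniform measures on the fibres of \<open>P\<close>
  over arcsine-distributed levels \<open>w\<close>. For \<open>\<zeta>\<close> in \<open>K\<close>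
  with \<open>P\<close>-value \<open>u\<close>, the kernel summed over a fibre is a constant minus
  \<open>ln \<bar>u - w\<bar>\<close>, whose arcsine average does not depend on
  \<open>u\<close>.\<close>

lemma exists_equilibrium_measure:
  fixes P :: "complex poly"
  assumes deg: "degree P > 0"
    and K: "K = {z. poly P z \<in> complex_of_real ` {0..1}}" "bounded K" "K \<subseteq> \<real>"
    and D: "D > 0" "\<And>z w. z \<in> K \<Longrightarrow> w \<in> K \<Longrightarrow> cmod (z - w) \<le> D"
  defines "V \<equiv> ln (4 * cmod (lead_coeff P)) / degree P"
  obtains \<omega> where "\<omega> \<in> prob_measures_on K" "0 \<le> ln D + V"
    "\<And>\<zeta>. \<zeta> \<in> K \<Longrightarrow> (\<integral>\<^sup>+ w. shifted_log_kernel D \<zeta> w \<partial>\<omega>) = ennreal (ln D + V)"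
proof -
  define N where "N = degree P"
  define a where "a = lead_coeff P"
  have N: "N > 0" and a: "a \<noteq> 0" using deg by (auto simp: N_def a_def)
  define p where "p = (\<lambda>x. Re (poly P (complex_of_real x)))"
  define L where "L = {x. complex_of_real x \<in> K}"
  have polyL: "poly P (of_real x) = of_real (p x)" "p x \<in> {0..1}" if "x \<in> L" for x
    using that by (auto simp: L_def K p_def)
  have contp: "continuous_on A p" for A unfolding p_def by (intro continuous_intros)
  have closedK: "closed K"
  proof -
    have "closed (poly P -` (complex_of_real ` {0..1}))"
      by (intro continuous_closed_vimage compact_imp_closed compact_continuous_image continuous_intros) auto
    then show ?thesis by (simp add: K vimage_def)
  qed
  have compL: "compact L"
  proof -
    have "L = complex_of_real -` K" by (auto simp: L_def)
    then have "closed L" using closedK by (simp add: continuous_closed_vimage)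
    moreover have "bounded L"
    proof -
      obtain b where "\<And>z. z \<in> K \<Longrightarrow> cmod z \<le> b" using K(2) by (auto simp: bounded_iff)
      then have "\<bar>x\<bar> \<le> b" if "x \<in> L" for x using that unfolding L_def by (metis mem_Collect_eq norm_of_real)
      then show ?thesis by (auto simp: bounded_iff)
    qed
    ultimately show ?thesis by (simp add: compact_eq_bounded_closed)
  qed
  define F where "F = (\<lambda>w. {x \<in> L. p x = w})"
  define Q where "Q = (\<lambda>w. P - [:complex_of_real w:])"
  have Q: "degree (Q w) = N" "lead_coeff (Q w) = a" "Q w \<noteq> 0" for w
  proof -
    show *: "degree (Q w) = N"
      unfolding Q_def diff_conv_add_uminus N_def by (rule degree_add_eq_left) (use deg in simp)
    show "lead_coeff (Q w) = a"
      using N unfolding * by (simp add: Q_def a_def N_def coeff_pCons split: nat.splits)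
    show "Q w \<noteq> 0" using * N by auto
  qed
  have F: "{z. poly (Q w) z = 0} = complex_of_real ` F w" if w: "w \<in> {0..1}" for w
  proof (intro equalityI subsetI)
    fix z assume "z \<in> {z. poly (Q w) z = 0}"
    then have z: "poly P z = of_real w" by (simp add: Q_def)
    then have "z \<in> K" using w by (auto simp: K)
    then obtain x where "z = of_real x" using K(3) by (metis Reals_cases subsetD)
    with z \<open>z \<in> K\<close> show "z \<in> complex_of_real ` F w" by (auto simp: F_def L_def p_def)
  qed (auto simp: F_def Q_def polyL)
  have finF: "finite (F w)" for w
  proof (cases "w \<in> {0..1}")
    case True
    have "finite (complex_of_real ` F w)"
      unfolding F[OF True, symmetric] by (rule poly_roots_finite[OF Q(3)])
    then show ?thesis by (rule finite_imageD) (auto intro: inj_onI)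
  next
    case False
    then have "F w = {}" using polyL(2) by (auto simp: F_def)
    then show ?thesis by simp
  qed
  \<comment> \<open>Contains all real critical values; every level of \<open>{0..1}\<close> outside
    this finite set has exactly \<open>N\<close> preimages.\<close>
  define C where "C = (\<lambda>z. Re (poly P z)) ` {z. poly (pderiv P) z = 0}"
  have "pderiv P \<noteq> 0" using deg by (simp add: pderiv_eq_0_iff)
  then have finC: "finite C" unfolding C_def by (intro finite_imageI poly_roots_finite)
  define G where "G = {0..1} - C"
  have G [measurable]: "G \<in> sets borel"
    unfolding G_def using finC by (intro sets.Diff) (auto intro: borel_closed finite_imp_closed)
  have rsq: "rsquarefree (Q w)" if "w \<in> G" for w
    unfolding rsquarefree_roots
  proof safe
    fix z assume "poly (Q w) z = 0" "poly (pderiv (Q w)) z = 0"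
    then have "w \<in> C"
      by (auto simp: C_def Q_def pderiv_diff pderiv_pCons intro!: image_eqI[of _ _ z])
    then show False using that by (simp add: G_def)
  qed
  have cardF: "card (F w) = N" if "w \<in> G" for w
  proof -
    have "card (complex_of_real ` F w) = N"
      using rsquarefree_complex_card_roots[OF rsq[OF that]] F[of w] that Q by (simp add: G_def)
    then show ?thesis by (subst (asm) card_image) (auto intro: inj_onI)
  qed
  obtain x0 where x0: "x0 \<in> L"
  proof -
    obtain z where "poly P z = 0"
      using fundamental_theorem_of_algebra[of P] deg by (metis constant_degree less_irrefl)
    then have "z \<in> K" by (auto simp: K image_iff intro!: bexI[of _ 0])
    then obtain x where "z = of_real x" using K(3) by (metis Reals_cases subsetD)
    with \<open>z \<in> K\<close> show ?thesis using that by (auto simp: L_def)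
  qed
  \<comment> \<open>The roots over \<open>w\<close> in increasing order. The default
    \<open>x0\<close> lies in \<open>L\<close>, so \<open>Z\<close> never leaves \<open>L\<close>
    and \<open>\<omega>\<close> has full mass on \<open>K\<close>.\<close>
  define Z where "Z = (\<lambda>k w. if k < N then (if w \<in> G then sorted_list_of_set (F w) ! k else x0) else x0)"
  have ZL: "Z k w \<in> L" for k w
  proof (cases "k < N \<and> w \<in> G")
    case True
    then have "sorted_list_of_set (F w) ! k \<in> set (sorted_list_of_set (F w))"
      using cardF by (intro nth_mem) simp
    then show ?thesis using True finF by (simp add: Z_def F_def)
  qed (auto simp: Z_def x0)
  have Zm [measurable]: "Z k \<in> borel_measurable borel" for k
  proof (cases "k < N")
    case True
    have "(\<lambda>w. if w \<in> G then sorted_list_of_set (F w) ! k else x0) \<in> borel_measurable borel"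
      unfolding F_def
      by (rule measurable_fibre_selection[OF compL contp finF[unfolded F_def] G])
         (use cardF True in \<open>simp add: F_def\<close>)
    then show ?thesis using True by (simp add: Z_def)
  qed (simp add: Z_def)
  have sumZ: "(\<Sum>k<N. f (Z k w)) = (\<Sum>x\<in>F w. f x)" if "w \<in> G" for w and f :: "real \<Rightarrow> ennreal"
  proof -
    have "(\<Sum>k<N. f (Z k w)) = (\<Sum>k<N. f (sorted_list_of_set (F w) ! k))"
      using that by (intro sum.cong) (auto simp: Z_def)
    also have "\<dots> = (\<Sum>x\<in>F w. f x)"
      by (rule sum.reindex_bij_betw, rule bij_betw_nth) (use that finF cardF in auto)
    finally show ?thesis .
  qed
  define U where "U = uniform_measure lborel {0..pi}"
  interpret U: prob_space U unfolding U_def by (rule prob_space_uniform_measure) auto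
  have [measurable_cong]: "sets U = sets borel" by (simp add: U_def)
  \<comment> \<open>A uniform index and an independent uniform angle:
    \<open>(1 + cos \<theta>) / 2\<close> then follows the arcsine law, and \<open>T\<close> picks
    the root with that index over it.\<close>
  define \<Omega> where "\<Omega> = measure_pmf (pmf_of_set {..<N}) \<Otimes>\<^sub>M U"
  interpret \<Omega>: prob_space \<Omega> unfolding \<Omega>_def
    by (intro prob_space_pair measure_pmf.prob_space_axioms U.prob_space_axioms)
  define T where "T = (\<lambda>q. complex_of_real (Z (fst q) ((1 + cos (snd q)) / 2)))"
  have Tm [measurable]: "T \<in> borel_measurable \<Omega>"
  proof -
    have "sets \<Omega> = sets (count_space UNIV \<Otimes>\<^sub>M U)"
      unfolding \<Omega>_def by (intro sets_pair_measure_cong) auto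
    moreover have "T \<in> borel_measurable (count_space UNIV \<Otimes>\<^sub>M U)"
      by (rule measurable_pair_measure_countable1) (auto simp: T_def)
    ultimately show ?thesis by (simp cong: measurable_cong_sets)
  qed
  define \<omega> where "\<omega> = distr \<Omega> borel T"
  have int\<omega>: "(\<integral>\<^sup>+ z. f z \<partial>\<omega>)
      = (\<integral>\<^sup>+ \<theta>. (\<Sum>k<N. f (of_real (Z k ((1 + cos \<theta>) / 2)))) \<partial>U) / of_nat N"
    if [measurable]: "f \<in> borel_measurable borel" for f :: "complex \<Rightarrow> ennreal"
  proof -
    have "(\<integral>\<^sup>+ z. f z \<partial>\<omega>) = (\<integral>\<^sup>+ q. f (T q) \<partial>\<Omega>)"
      unfolding \<omega>_def by (rule nn_integral_distr) measurable
    also have "\<dots> = (\<integral>\<^sup>+ k. \<integral>\<^sup>+ \<theta>. f (T (k, \<theta>)) \<partial>U \<partial>measure_pmf (pmf_of_set {..<N}))"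
      unfolding \<Omega>_def by (rule U.nn_integral_fst[symmetric]) (use Tm in \<open>simp add: \<Omega>_def\<close>)
    also have "\<dots> = (\<Sum>k<N. \<integral>\<^sup>+ \<theta>. f (T (k, \<theta>)) \<partial>U) / of_nat N"
      using N by (subst nn_integral_pmf_of_set) auto
    also have "(\<Sum>k<N. \<integral>\<^sup>+ \<theta>. f (T (k, \<theta>)) \<partial>U) = (\<integral>\<^sup>+ \<theta>. (\<Sum>k<N. f (T (k, \<theta>))) \<partial>U)"
      by (rule nn_integral_sum[symmetric]) (simp add: T_def)
    finally show ?thesis by (simp add: T_def)
  qed
  have "prob_space \<omega>" unfolding \<omega>_def by (rule \<Omega>.prob_space_distr) measurable
  moreover have "emeasure \<omega> K = 1"
  proof -
    have "K \<in> sets borel" using closedK by (rule borel_closed)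
    moreover have "T -` K \<inter> space \<Omega> = space \<Omega>" using ZL by (auto simp: T_def L_def)
    ultimately show ?thesis by (simp add: \<omega>_def emeasure_distr \<Omega>.emeasure_space_1)
  qed
  ultimately have mem: "\<omega> \<in> prob_measures_on K" by (simp add: prob_measures_on_def \<omega>_def)
  \<comment> \<open>The part of the fibre sum independent of \<open>u\<close> and \<open>w\<close>;
    the arcsine average adds \<open>ln 4\<close>.\<close>
  define c where "c = N * ln D + ln (cmod a)"
  have V: "c + ln 4 = N * (ln D + V)"
    unfolding V_def c_def a_def N_def using deg by (simp add: ln_mult field_simps)
  have main: "(\<integral>\<^sup>+ w. shifted_log_kernel D \<zeta> w \<partial>\<omega>) = ennreal (ln D + V) \<and> 0 \<le> ln D + V"
    if \<zeta>: "\<zeta> \<in> K" for \<zeta>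
  proof -
    obtain u where u: "u \<in> {0..1}" "poly P \<zeta> = of_real u" using \<zeta> by (auto simp: K)
    let ?w = "\<lambda>\<theta>. (1 + cos \<theta>) / (2::real)"
    let ?f = "\<lambda>\<theta>. \<Sum>k<N. shifted_log_kernel D \<zeta> (of_real (Z k (?w \<theta>)))"
    \<comment> \<open>Angles whose level is critical, or equals \<open>u\<close>, where
      \<open>\<zeta>\<close> itself lies in the fibre and the kernel is infinite. The set is finite
      because the cosine is injective on \<open>{0..pi}\<close>.\<close>
    define E where "E = ?w -` (insert u C) \<inter> {0..pi}"
    have finE: "finite E"
      unfolding E_def by (rule finite_vimage_IntI) (use finC in \<open>auto intro!: inj_onI dest: cos_inj_pi\<close>)
    have f: "?f \<theta> = ennreal (c - ln \<bar>u - ?w \<theta>\<bar>) \<and> 0 \<le> c - ln \<bar>u - ?w \<theta>\<bar>"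
      if \<theta>: "\<theta> \<in> {0..pi} - E" for \<theta>
    proof -
      define w where "w = ?w \<theta>"
      have "(1 + t) / 2 \<in> {0..1}" if "- 1 \<le> t" "t \<le> 1" for t :: real using that by simp
      from this[OF cos_ge_minus_one cos_le_one] have w01: "w \<in> {0..1}" unfolding w_def .
      have w: "w \<in> G" "w \<noteq> u" using \<theta> w01 by (auto simp: E_def G_def w_def)
      have ev: "poly (Q w) \<zeta> = of_real (u - w)" by (simp add: Q_def u)
      have ne: "\<zeta> \<noteq> of_real x" if "x \<in> F w" for x
      proof
        assume "\<zeta> = of_real x"
        then have "poly (Q w) \<zeta> = 0" using that F[OF w01] by blast
        then show False using ev w by simp
      qed
      have le: "cmod (\<zeta> - of_real x) \<le> D" if "x \<in> F w" for x
        using that \<zeta> by (intro D) (auto simp: F_def L_def)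
      have pos: "0 \<le> ln (D / cmod (\<zeta> - of_real x))" if "x \<in> F w" for x
        using ne[OF that] le[OF that] by simp
      have "(\<Sum>k<N. shifted_log_kernel D \<zeta> (of_real (Z k w)))
          = (\<Sum>x\<in>F w. shifted_log_kernel D \<zeta> (of_real x))" by (rule sumZ[OF w(1)])
      also have "\<dots> = (\<Sum>x\<in>F w. ennreal (ln (D / cmod (\<zeta> - of_real x))))"
        using ne by (intro sum.cong) (auto simp: shifted_log_kernel_def)
      also have "\<dots> = ennreal (\<Sum>x\<in>F w. ln (D / cmod (\<zeta> - of_real x)))"
        using pos by (rule sum_ennreal)
      finally have "(\<Sum>k<N. shifted_log_kernel D \<zeta> (of_real (Z k w)))
        = ennreal (\<Sum>x\<in>F w. ln (D / cmod (\<zeta> - of_real x)))" .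
      moreover have "(\<Sum>x\<in>F w. ln (D / cmod (\<zeta> - of_real x))) = c - ln \<bar>u - w\<bar>"
      proof -
        have "(\<Sum>x\<in>F w. ln (D / cmod (\<zeta> - of_real x))) = (\<Sum>z | poly (Q w) z = 0. ln (D / cmod (\<zeta> - z)))"
          unfolding F[OF w01] by (subst sum.reindex) (auto intro: inj_onI)
        also have "\<dots> = c - ln \<bar>u - w\<bar>"
          using w ev by (subst sum_ln_dist_roots[OF rsq[OF w(1)] _ D(1)])
            (simp_all add: Q(1) Q(2)[unfolded Q(1)] c_def del: of_real_diff)
        finally show ?thesis .
      qed
      moreover have "0 \<le> (\<Sum>x\<in>F w. ln (D / cmod (\<zeta> - of_real x)))" using pos by (rule sum_nonneg)
      ultimately show ?thesis by (simp add: w_def)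
    qed
    have fU: "(\<integral>\<^sup>+ \<theta>. ?f \<theta> \<partial>U) = ennreal (c + ln 4)" and nn: "0 \<le> c + ln 4"
      unfolding U_def by (rule nn_integral_arcsine_potential[OF u(1) finE f]; simp)+
    have "(\<integral>\<^sup>+ w. shifted_log_kernel D \<zeta> w \<partial>\<omega>) = ennreal (N * (ln D + V)) / of_nat N"
      by (subst int\<omega>) (simp_all add: fU V)
    moreover have "0 \<le> ln D + V" using nn N unfolding V by (simp add: zero_le_mult_iff)
    ultimately show ?thesis
      using N by (simp add: divide_ennreal ennreal_of_nat_eq_real_of_nat)
  qed
  from x0 have "of_real x0 \<in> K" by (simp add: L_def)
  with main show ?thesis using that[OF mem] by blast
qed

section \<open>Logarithmic capacity of a real preimage\<close>

theorem Cap_power_preimage_interval: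
  fixes P :: "complex poly"
  assumes deg: "degree P > 0"
    and K: "K = {z. poly P z \<in> complex_of_real ` {0..1}}" "bounded K" "K \<subseteq> \<real>"
  shows "Cap K ^ degree P = 1 / (4 * cmod (lead_coeff P))"
proof -
  define D where "D = cap_shift K"
  define V where "V = ln (4 * cmod (lead_coeff P)) / degree P"
  have D: "D > 0" using diameter_ge_0[OF K(2)] by (simp add: D_def cap_shift_def)
  have DK: "cmod (z - w) \<le> D" if "z \<in> K" "w \<in> K" for z w
    using diameter_bounded_bound[OF K(2) that] by (simp add: D_def cap_shift_def dist_norm)
  obtain \<omega> where \<omega>: "\<omega> \<in> prob_measures_on K" and V: "0 \<le> ln D + V"
    and pot: "\<And>\<zeta>. \<zeta> \<in> K \<Longrightarrow> (\<integral>\<^sup>+ w. shifted_log_kernel D \<zeta> w \<partial>\<omega>) = ennreal (ln D + V)"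
    using exists_equilibrium_measure[OF deg K D DK] unfolding V_def by blast
  have props: "prob_space \<mu>" "sets \<mu> = sets borel" "AE z in \<mu>. z \<in> K"
    if "\<mu> \<in> prob_measures_on K" for \<mu>
  proof -
    show p: "prob_space \<mu>" "sets \<mu> = sets borel" using that by (auto simp: prob_measures_on_def)
    have e: "emeasure \<mu> K = 1" using that by (simp add: prob_measures_on_def)
    then have "K \<in> sets \<mu>" by (intro emeasure_neq_0_sets) simp
    then show "AE z in \<mu>. z \<in> K"
      using prob_space.AE_in_set_eq_1[OF p(1)] e by (simp add: measure_def)
  qed
  \<comment> \<open>The potential of \<open>\<omega>\<close> is constant on \<open>K\<close>, which
    carries \<open>\<mu>\<close>; so the mixed energy is the same for every competitor,
    \<open>\<omega>\<close> included.\<close>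
  have cross: "(\<integral>\<^sup>+ z. \<integral>\<^sup>+ w. shifted_log_kernel D z w \<partial>\<omega> \<partial>\<mu>) = ennreal (ln D + V)"
    if "\<mu> \<in> prob_measures_on K" for \<mu>
  proof -
    interpret prob_space \<mu> using props(1)[OF that] .
    have "(\<integral>\<^sup>+ z. \<integral>\<^sup>+ w. shifted_log_kernel D z w \<partial>\<omega> \<partial>\<mu>) = (\<integral>\<^sup>+ z. ennreal (ln D + V) \<partial>\<mu>)"
      by (rule nn_integral_cong_AE) (use props(3)[OF that] pot in \<open>auto elim: eventually_mono\<close>)
    then show ?thesis by (simp add: emeasure_space_1)
  qed
  have "robin_constant K = ereal V"
    unfolding robin_constant_def
  proof (rule antisym)
    have "log_energy K \<omega> = ereal V"
      using V by (simp add: log_energy_def cross[OF \<omega>, unfolded D_def] D_def)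
    then show "(INF \<mu> \<in> prob_measures_on K. log_energy K \<mu>) \<le> ereal V"
      using \<omega> by (metis INF_lower)
  next
    show "ereal V \<le> (INF \<mu> \<in> prob_measures_on K. log_energy K \<mu>)"
    proof (rule INF_greatest)
      fix \<mu> assume \<mu>: "\<mu> \<in> prob_measures_on K"
      let ?I = "\<integral>\<^sup>+ z. \<integral>\<^sup>+ w. shifted_log_kernel D z w \<partial>\<mu> \<partial>\<mu>"
      \<comment> \<open>The mixed energy on the left and the energy of \<open>\<omega>\<close> on
        the right have the same finite value; cancelling it leaves the lower bound for
        \<open>?I\<close>.\<close>
      have "2 * ennreal (ln D + V) \<le> ?I + ennreal (ln D + V)"
        using shifted_log_kernel_cross_energy_le[OF props(1)[OF \<mu>] props(1)[OF \<omega>]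
            props(2)[OF \<mu>] props(2)[OF \<omega>] K(3) props(3)[OF \<mu>] props(3)[OF \<omega>] D DK]
        by (simp add: cross \<mu> \<omega>)
      then have "ennreal (ln D + V) \<le> ?I"
        by (simp add: mult_2 add.commute[of ?I] ennreal_add_left_cancel_le)
      then have "ereal (ln D + V) \<le> enn2ereal ?I"
        using V by (metis enn2ereal_ennreal less_eq_ennreal.rep_eq)
      then show "ereal V \<le> log_energy K \<mu>"
        unfolding log_energy_def D_def[symmetric] by (cases "enn2ereal ?I") auto
    qed
  qed
  then have "Cap K = exp (- V)" by (simp add: Cap_def)
  then have "Cap K ^ degree P = exp (- (degree P * V))" by (simp add: exp_of_nat_mult[symmetric])
  also have "degree P * V = ln (4 * cmod (lead_coeff P))" using deg by (simp add: V_def)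
  also have "exp (- ln (4 * cmod (lead_coeff P))) = 1 / (4 * cmod (lead_coeff P))"
    using deg by (subst exp_minus, subst exp_ln) (auto simp: inverse_eq_divide)
  finally show ?thesis .
qed

subsection \<open>Weighted squares\<close>

text \<open>With only real roots, \<open>S\<close> divided by its leading coefficient takes a real
  value \<open>y\<close> at \<open>x\<close>, so the squared leading coefficient is
  \<open>1 / (b * y\<^sup>2)\<close>. The form with \<open>cmod\<close> fits the modulus in the
  capacity formula.\<close>

lemma lead_coeff_square_pos:
  fixes S :: "complex poly"
  assumes S: "\<And>z. poly S z = 0 \<Longrightarrow> z \<in> \<real>" and "S \<noteq> 0"
    and x: "b \<ge> 0" "complex_of_real b * (poly S (complex_of_real x))\<^sup>2 = 1"
  shows "(lead_coeff S)\<^sup>2 = complex_of_real (cmod ((lead_coeff S)\<^sup>2))"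
proof -
  have "poly S (of_real x) = lead_coeff S * poly (\<Prod>z\<in>#proots S. [:-z, 1:]) (of_real x)"
    by (subst complex_poly_decompose_multiset[of S, symmetric]) simp
  moreover have "poly (\<Prod>z\<in>#Z. [:-z, 1:]) (of_real x) \<in> \<real>" if "set_mset Z \<subseteq> \<real>"
    for Z :: "complex multiset"
    using that by (induction Z) auto
  then have "poly (\<Prod>z\<in>#proots S. [:-z, 1:]) (of_real x) \<in> \<real>"
    using S \<open>S \<noteq> 0\<close> by (simp add: subset_iff)
  then obtain y where "poly (\<Prod>z\<in>#proots S. [:-z, 1:]) (of_real x) = of_real y" by (rule Reals_cases)
  ultimately have eq: "(lead_coeff S)\<^sup>2 * of_real (b * y\<^sup>2) = 1"
    using x(2) by (simp add: power_mult_distrib ac_simps)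
  then have ne: "b * y\<^sup>2 \<noteq> 0" by force
  then have "(lead_coeff S)\<^sup>2 = of_real (1 / (b * y\<^sup>2))"
    using eq by (simp add: field_simps del: of_real_mult)
  moreover have "1 / (b * y\<^sup>2) \<ge> 0" using x(1) by simp
  ultimately show ?thesis by (metis abs_of_nonneg norm_of_real)
qed

text \<open>The sign \<open>\<sigma>\<close> treats both weights at once. The leading coefficient is
  \<open>\<sigma>\<close> times the square \<open>c\<^sup>2\<close>, and \<open>\<sigma>\<close> is
  its own inverse, which puts it in front. The constants match because \<open>c\<^sup>2\<close>
  equals its modulus.\<close>

lemma chebyshev_poly_weighted_square:
  fixes S :: "complex poly" and \<sigma> :: real
  assumes \<sigma>: "\<bar>\<sigma>\<bar> = 1" and n: "degree S = n" "n \<ge> 1"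
    and K: "K = {z. poly ([:1, complex_of_real \<sigma>:] * S ^ 2) z \<in> complex_of_real ` {0..1}}"
      "K \<subseteq> complex_of_real ` {-1..1}"
  shows "chebyshev_poly K (2 * n + 1) = smult (of_real \<sigma>)
    (smult (1 / (lead_coeff S)\<^sup>2) ([:1, complex_of_real \<sigma>:] * S ^ 2)
      - [:2 * complex_of_real (Cap K ^ (2 * n + 1)):])"
proof -
  define P where "P = [:1, complex_of_real \<sigma>:] * S ^ 2"
  define c where "c = lead_coeff S"
  have \<sigma>0: "complex_of_real \<sigma> \<noteq> 0" "\<sigma> * \<sigma> = 1" using \<sigma> by (auto simp: abs_if split: if_splits)
  have S0: "S \<noteq> 0" using n by auto
  have deg: "degree P = 2 * n + 1"
    unfolding P_def using \<sigma>0 S0 n by (subst degree_mult_eq) (auto simp: degree_power_eq)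
  have lead: "lead_coeff P = of_real \<sigma> * c\<^sup>2"
    unfolding P_def lead_coeff_mult using \<sigma>0 by (simp add: lead_coeff_power c_def)
  have KP: "K = {z. poly P z \<in> complex_of_real ` {0..1}}" by (simp only: K(1) P_def)
  have "bounded (complex_of_real ` {-1..1})"
    by (intro compact_imp_bounded compact_continuous_image continuous_intros) auto
  then have bd: "bounded K" using K(2) bounded_subset by blast
  have re: "K \<subseteq> \<real>" using K(2) by auto
  have cheb: "chebyshev_poly K (2 * n + 1) = smult (1 / lead_coeff P) (P - [:1 / 2:])"
    using chebyshev_poly_preimage_interval[OF _ KP bd] deg by simp
  have cap: "Cap K ^ (2 * n + 1) = 1 / (4 * cmod (c\<^sup>2))"
    using Cap_power_preimage_interval[OF _ KP bd re, unfolded lead] \<sigma> by (simp add: deg norm_mult)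
  have pos: "c\<^sup>2 = complex_of_real (cmod (c\<^sup>2))"
  proof -
    \<comment> \<open>A point where \<open>P\<close> is 1 lies in \<open>K\<close>, hence in the
      real interval, where the weight \<open>1 + \<sigma> * x\<close> is nonnegative.\<close>
    have "\<not> constant (poly (P - [:1:]))"
      unfolding constant_degree diff_conv_add_uminus
      by (subst degree_add_eq_left) (simp_all add: deg)
    then obtain z where z: "poly P z = 1" using fundamental_theorem_of_algebra by fastforce
    then have "z \<in> K" by (auto simp: KP image_iff intro!: bexI[of _ 1])
    then obtain x where x: "x \<in> {-1..1}" "z = of_real x" using K(2) by auto
    show ?thesis unfolding c_def
    proof (rule lead_coeff_square_pos[OF _ S0])
      fix y assume "poly S y = 0"
      then have "poly P y = 0" by (simp add: P_def)
      then have "y \<in> K" by (auto simp: KP image_iff intro!: bexI[of _ 0])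
      then show "y \<in> \<real>" using re by blast
    next
      show "0 \<le> 1 + \<sigma> * x" using \<sigma> x by (auto simp: abs_if split: if_splits)
      show "complex_of_real (1 + \<sigma> * x) * (poly S (complex_of_real x))\<^sup>2 = 1"
        using z by (simp add: P_def x algebra_simps)
    qed
  qed
  have c0: "c \<noteq> 0" using S0 by (simp add: c_def)
  have cap': "2 * complex_of_real (Cap K ^ (2 * n + 1)) = 1 / (2 * c\<^sup>2)"
    unfolding cap by (subst (2) pos) simp
  have "1 / (of_real \<sigma> * c\<^sup>2) = of_real \<sigma> / c\<^sup>2"
    using c0 \<sigma>0 by (simp add: field_simps flip: of_real_mult)
  then show ?thesis
    unfolding cheb lead cap' P_def[symmetric] c_def[symmetric]
    by (simp add: smult_diff_right)
qed

theorem theorem6: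
  fixes S :: "complex poly" and n :: nat and c :: complex
  assumes "n \<ge> 1" and "degree S = n" and "c = lead_coeff S"
  shows
   "({z. poly ([:1, 1:] * S ^ 2) z \<in> complex_of_real ` {0..1}} \<subseteq> complex_of_real ` {-1..1}
      \<longrightarrow> chebyshev_poly {z. poly ([:1, 1:] * S ^ 2) z \<in> complex_of_real ` {0..1}} (2 * n + 1)
          = smult (1 / c ^ 2) ([:1, 1:] * S ^ 2)
            - [: 2 * complex_of_real (Cap {z. poly ([:1, 1:] * S ^ 2) z \<in> complex_of_real ` {0..1}} ^ (2 * n + 1)) :])
    \<and>
    ({z. poly ([:1, -1:] * S ^ 2) z \<in> complex_of_real ` {0..1}} \<subseteq> complex_of_real ` {-1..1}
      \<longrightarrow> chebyshev_poly {z. poly ([:1, -1:] * S ^ 2) z \<in> complex_of_real ` {0..1}} (2 * n + 1)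
          = [: 2 * complex_of_real (Cap {z. poly ([:1, -1:] * S ^ 2) z \<in> complex_of_real ` {0..1}} ^ (2 * n + 1)) :]
            - smult (1 / c ^ 2) ([:1, -1:] * S ^ 2))"
proof (intro conjI impI)
  let ?K = "\<lambda>\<sigma>. {z. poly ([:1, \<sigma>:] * S ^ 2) z \<in> complex_of_real ` {0..1}}"
  have one: "complex_of_real 1 = 1" "complex_of_real (- 1) = - 1" by simp_all
  {
    assume "?K 1 \<subseteq> complex_of_real ` {-1..1}"
    with chebyshev_poly_weighted_square[of 1 S n "?K 1", unfolded one] assms
    show "chebyshev_poly (?K 1) (2 * n + 1) = smult (1 / c ^ 2) ([:1, 1:] * S ^ 2)
        - [: 2 * complex_of_real (Cap (?K 1) ^ (2 * n + 1)) :]"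
      by (simp del: mult_pCons_left)
  next
    assume "?K (- 1) \<subseteq> complex_of_real ` {-1..1}"
    with chebyshev_poly_weighted_square[of "- 1" S n "?K (- 1)", unfolded one] assms
    show "chebyshev_poly (?K (- 1)) (2 * n + 1)
        = [: 2 * complex_of_real (Cap (?K (- 1)) ^ (2 * n + 1)) :] - smult (1 / c ^ 2) ([:1, -1:] * S ^ 2)"
      by (simp del: mult_pCons_left)
  }
qed

end
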